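(* Let $X$ be a Polish space, let $(a_n)$ be a sequence of strictly positive real numbers with $\lim_n a_n=+\infty$, let $(\mu_n)$ be a sequence in $\mathcal{P}(X)$, and let $I\colon X\to[0,+\infty]$ be a measurable function. Define $H_n^{\mathbf a}\colon \mathcal P(X)\to[0,+\infty]$ by $H_n^{\mathbf a}(\nu)=\frac1{a_n}H(\nu|\mu_n)$ and $l_n^{\mathbf a}\colon \mathfrak K(X)\to[0,+\infty]$ by $l_n^{\mathbf a}(K)=-\frac1{a_n}\log\mu_n(K)$. Then the following are equivalent. (P1) $(\mu_n)$ satisfies a large deviations lower bound with speed $(a_n)$ and rate $I$. (P2) For each sequence $(\varphi_n)$ of measurable maps $\varphi_n\colon X\to[-\infty,+\infty]$ $$\varliminf_n\tfrac1{a_n}\log\mu_n\big(\exp(a_n\varphi_n)\big)\ \ge\ \sup_{x\in X}\big\{\big(\Gamma\text{-}\varliminf_n\varphi_n\big)(x)-I(x)\big\},$$ where one understands $\big(\Gamma\text{-}\varliminf_n\varphi_n\big)(x)-I(x)=-\infty$ whenever $I(x)=+\infty$. (H1) For each $x\in X$, $\big(\Gamma\text{-}\varlimsup_n H_n^{\mathbf a}\big)(\delta_x)\le I(x)$, where $\delta_x\in\mathcal P(X)$ is the Dirac mass concentrated at $x$. (H2) For each $\nu\in\mathcal P(X)$, $\big(\Gamma\text{-}\varlimsup_n H_n^{\mathbf a}\big)(\nu)\le\nu(I)$. If $I$ is lower semicontinuous, the statements (P1), (P2), (H1) and (H2) are also equivalent to (L) $\Gamma\text{-}\varlimsup_n l_n^{\mathbf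 a}\le l_I$ on $\mathfrak K(X)$, where $l_I(K)=\inf_{x\in K}I(x)$.
   Context: $\mathcal P(X)$ is the space of Borel probability measures on $X$ with the narrow (weak) topology; $\mu(f)$ denotes the integral of $f$ with respect to $\mu$. $\mathfrak K(X)$ is the collection of compact subsets of $X$ with the Hausdorff topology, i.e. the topology of the distance $d_H(K,K')=\inf\{\varepsilon>0: K\subset K'^{\varepsilon},\ K'\subset K^{\varepsilon}\}$, where $A^\varepsilon$ is the $\varepsilon$-enlargement of $A$ for a fixed compatible distance on $X$. The relative entropy is $H(\nu|\mu)=\sup_\varphi\{\nu(\varphi)-\log\mu(e^\varphi)\}$, the supremum being over bounded Borel functions $\varphi$ on $X$. Convention: $-\log0=+\infty$. $(\mu_n)$ satisfies a large deviations lower bound with speed $(a_n)$ and rate $I$ iff for each open $O\subset X$, $\varliminf_n\frac1{a_n}\log\mu_n(O)\ge-\inf_{x\in O}I(x)$. For a sequence of functions $F_n\colon Z\to[-\infty,+\infty]$ on a Polish space $Z$ and $z\in Z$: $\big(\Gamma\text{-}\varliminf_nF_n\big)(z)=\inf\{\varliminf_nF_n(z_n)\}$ and $\big(\Gamma\text{-}\varlimsup_nF_n\big)(z)=\inf\{\varlimsup_nF_n(z_n)\}$, both infima being over all sequences $(z_n)$ in $Z$ with $z_n\to z$. *)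

theory Defs
  imports "HOL-Probability.Probability"
begin

text \<open>Logarithm \<open>[0,\<infinity>] \<rightarrow> [-\<infinity>,\<infinity>]\<close> and exponential \<open>[-\<infinity>,\<infinity>] \<rightarrow> [0,\<infinity>]\<close>, with
  \<open>log 0 = -\<infinity>\<close> and \<open>log \<infinity> = \<infinity>\<close>.\<close>

definition ln_ennreal :: "ennreal \<Rightarrow> ereal" where
  "ln_ennreal x = (if x = 0 then -\<infinity> else if x = \<infinity> then \<infinity> else ereal (ln (enn2real x)))"

definition exp_ereal :: "ereal \<Rightarrow> ennreal" where
  "exp_ereal x = (case x of ereal r \<Rightarrow> ennreal (exp r) | PInfty \<Rightarrow> \<infinity> | MInfty \<Rightarrow> 0)"

abbreviation borel_probs :: "'a::topological_space measure set" where
  "borel_probs \<equiv> space (prob_algebra borel)"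

definition narrow_topology :: "'a::topological_space measure topology" where
  "narrow_topology = topology_generated_by
     {{\<nu> \<in> borel_probs. (\<integral>x. f x \<partial>\<nu>) \<in> U} | f U. f \<in> (bcontfun :: ('a \<Rightarrow> real) set) \<and> open U}"

text \<open>The infimum defining the Hausdorff distance is taken in \<open>[-\<infinity>,\<infinity>]\<close>: the empty set is
  compact and its distance to every nonempty set is \<open>\<infinity>\<close>.\<close>

definition enlargement :: "('a \<Rightarrow> 'a \<Rightarrow> real) \<Rightarrow> real \<Rightarrow> 'a set \<Rightarrow> 'a set" where
  "enlargement d \<epsilon> A = {x. \<exists>a\<in>A. d a x < \<epsilon>}"

definition hausdorff_edist :: "('a \<Rightarrow> 'a \<Rightarrow> real) \<Rightarrow> 'a set \<Rightarrow> 'a set \<Rightarrow> ereal" where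
  "hausdorff_edist d K K' =
     Inf {ereal \<epsilon> | \<epsilon>. \<epsilon> > 0 \<and> K \<subseteq> enlargement d \<epsilon> K' \<and> K' \<subseteq> enlargement d \<epsilon> K}"

definition hausdorff_topology ::
    "('a::topological_space \<Rightarrow> 'a \<Rightarrow> real) \<Rightarrow> 'a set topology" where
  "hausdorff_topology d = topology_generated_by
     {{K'. compact K' \<and> hausdorff_edist d K K' < ereal \<epsilon>} | K \<epsilon>. compact K \<and> \<epsilon> > 0}"

text \<open>The Gamma-limits are the sequential ones; the topology carries the space \<open>Z\<close>, so that the
  values of \<open>F\<close> outside \<open>topspace Z\<close> are irrelevant.\<close>

definition gamma_liminf :: "'z topology \<Rightarrow> (nat \<Rightarrow> 'z \<Rightarrow> ereal) \<Rightarrow> 'z \<Rightarrow> ereal" where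
  "gamma_liminf Z F z =
     (INF s\<in>{s. range s \<subseteq> topspace Z \<and> limitin Z s z sequentially}. liminf (\<lambda>n. F n (s n)))"

definition gamma_limsup :: "'z topology \<Rightarrow> (nat \<Rightarrow> 'z \<Rightarrow> ereal) \<Rightarrow> 'z \<Rightarrow> ereal" where
  "gamma_limsup Z F z =
     (INF s\<in>{s. range s \<subseteq> topspace Z \<and> limitin Z s z sequentially}. limsup (\<lambda>n. F n (s n)))"

definition relative_entropy :: "'a::topological_space measure \<Rightarrow> 'a measure \<Rightarrow> ereal" where
  "relative_entropy \<nu> \<mu> =
     (SUP \<phi>\<in>{\<phi> \<in> borel_measurable borel. bounded (range \<phi>)}.
        ereal ((\<integral>x. \<phi> x \<partial>\<nu>) - ln (\<integral>x. exp (\<phi> x) \<partial>\<mu>)))"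

definition ldp_lower_bound ::
    "(nat \<Rightarrow> 'a::topological_space measure) \<Rightarrow> (nat \<Rightarrow> real) \<Rightarrow> ('a \<Rightarrow> ennreal) \<Rightarrow> bool" where
  "ldp_lower_bound \<mu> a I \<longleftrightarrow>
     (\<forall>U. open U \<longrightarrow>
        liminf (\<lambda>n. ereal (1 / a n) * ln_ennreal (emeasure (\<mu> n) U)) \<ge> - (INF x\<in>U. enn2ereal (I x)))"

definition lower_semicontinuous :: "('a::topological_space \<Rightarrow> ennreal) \<Rightarrow> bool" where
  "lower_semicontinuous I \<longleftrightarrow> (\<forall>c. open {x. c < I x})"

text \<open>The functionals \<open>H\<^sub>n\<close> and \<open>l\<^sub>n\<close>, on \<open>borel_probs\<close> and on the compact sets.\<close>

definition scaled_entropy ::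
    "(nat \<Rightarrow> real) \<Rightarrow> (nat \<Rightarrow> 'a::topological_space measure) \<Rightarrow> nat \<Rightarrow> 'a measure \<Rightarrow> ereal" where
  "scaled_entropy a \<mu> n \<nu> = ereal (1 / a n) * relative_entropy \<nu> (\<mu> n)"

definition log_cost ::
    "(nat \<Rightarrow> real) \<Rightarrow> (nat \<Rightarrow> 'a::topological_space measure) \<Rightarrow> nat \<Rightarrow> 'a set \<Rightarrow> ereal" where
  "log_cost a \<mu> n K = - (ereal (1 / a n) * ln_ennreal (emeasure (\<mu> n) K))"

end

theory Submission
  imports Defs
begin

text \<open>
  The lower bound is a statement about single points: it says that for every neighbourhood \<open>U\<close> of
  \<open>x\<close> and every \<open>c > I x\<close>, eventually \<open>\<mu>\<^sub>n U \<ge> exp (- a\<^sub>n c)\<close> (\<open>ldp_lower_bound_iff\<close>). Each of the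
  other conditions is a way to spend or to recover this exponential estimate.

  For exponential integrals, a function sequence whose Gamma-liminf at \<open>x\<close> exceeds \<open>b\<close> is eventually
  above \<open>b\<close> on a whole neighbourhood of \<open>x\<close>, so its integral is at least \<open>exp (a\<^sub>n b) \<mu>\<^sub>n U\<close>.
  Conversely, the function that is \<open>0\<close> on \<open>U\<close> and \<open>-\<infinity>\<close> elsewhere has \<open>\<mu>\<^sub>n U\<close> as its exponential integral.

  For entropies, the link is that \<open>\<mu>\<^sub>n\<close> conditioned on \<open>U\<close> has entropy at most \<open>- ln (\<mu>\<^sub>n U)\<close>. Given
  \<open>\<nu>\<close> with \<open>\<nu>(I) < c\<close>, cut most of the mass of \<open>\<nu>\<close> into finitely many small cells. Each cell
  contains a point where \<open>I\<close> does not exceed its mean over the cell, and the mixture of the laws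
  \<open>\<mu>\<^sub>n\<close> conditioned on small balls around these points, with the weights of the cells, is close to
  \<open>\<nu>\<close>. By convexity of the entropy its scaled cost is eventually at most \<open>c\<close>
  (\<open>entropy_recovery_of_ldp_lower_bound\<close>). A diagonal argument over finer and finer cells
  (\<open>gamma_limsup_le_of_shrinking\<close>) gives a recovery sequence for \<open>\<nu>\<close>. The way back only uses Dirac
  masses: laws converging to the Dirac mass at \<open>x\<close> give almost full mass to \<open>U\<close>, and testing the
  entropy with a multiple of the indicator of \<open>U\<close> shows that an exponentially smaller \<open>\<mu>\<^sub>n U\<close>
  would make the entropy too large (\<open>ldp_lower_bound_of_entropy_at_points\<close>).

  For compact sets, inner regularity replaces a small open ball around a point of \<open>K\<close> by a compact
  subset of almost the same mass; its union with \<open>K\<close> is Hausdorff-close to \<open>K\<close>. Conversely, compact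
  sets that converge to \<open>{x}\<close> are eventually contained in \<open>U\<close>.
\<close>

section \<open>Exponential form of the lower bound\<close>

text \<open>Passes from the logarithmic scale back to masses; the conventions for the logarithm make it hold
at \<open>y = 0\<close> and \<open>y = \<infinity>\<close> as well, so that null sets need no separate treatment later.\<close>

lemma le_scaled_ln_iff:
  assumes "a > 0"
  shows "ereal b \<le> ereal (1 / a) * ln_ennreal y \<longleftrightarrow> ennreal (exp (a * b)) \<le> y"
proof (cases y rule: ennreal_cases)
  case top
  then show ?thesis
    using assms by (simp add: ln_ennreal_def)
next
  case (real r)
  show ?thesis
  proof (cases "r = 0")
    case True
    then show ?thesis
      using assms real by (simp add: ln_ennreal_def ennreal_eq_0_iff)
  next
    case False
    then have "r > 0"
      using real by simp
    then have "b \<le> 1 / a * ln r \<longleftrightarrow> exp (a * b) \<le> r"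
      using assms by (simp add: field_simps ln_ge_iff mult.commute)
    then show ?thesis
      using \<open>r > 0\<close> real by (simp add: ln_ennreal_def ennreal_eq_0_iff)
  qed
qed

lemma log_cost_le_iff:
  assumes "a n > 0"
  shows "log_cost a \<mu> n K \<le> ereal c \<longleftrightarrow> ennreal (exp (- (a n * c))) \<le> emeasure (\<mu> n) K"
  using le_scaled_ln_iff[OF assms, of "- c"] unfolding log_cost_def
  by (metis ereal_uminus_le_reorder mult_minus_right uminus_ereal.simps(1))

text \<open>The shape in which the large deviations lower bound is used and verified throughout: logarithms,
limits inferior and the infimum over \<open>U\<close> are replaced by eventual inequalities with a strict
margin \<open>c > I x\<close>, which absorbs all error terms.\<close>

lemma ldp_lower_bound_iff:
  assumes a_pos: "\<And>n. a n > 0"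
  shows "ldp_lower_bound \<mu> a I \<longleftrightarrow>
    (\<forall>U x c. open U \<longrightarrow> x \<in> U \<longrightarrow> enn2ereal (I x) < ereal c \<longrightarrow>
       (\<forall>\<^sub>F n in sequentially. ennreal (exp (- (a n * c))) \<le> emeasure (\<mu> n) U))"
    (is "?L \<longleftrightarrow> ?R")
proof
  assume ?L
  show ?R
  proof (intro allI impI)
    fix U x c
    assume *: "open U" "x \<in> U" "enn2ereal (I x) < ereal c"
    have "(INF x\<in>U. enn2ereal (I x)) < ereal c"
      using * by (auto simp: INF_less_iff)
    then have "ereal (- c) < - (INF x\<in>U. enn2ereal (I x))"
      by (metis ereal_minus_less_minus uminus_ereal.simps(1))
    also have "\<dots> \<le> liminf (\<lambda>n. ereal (1 / a n) * ln_ennreal (emeasure (\<mu> n) U))"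
      using \<open>?L\<close> * by (auto simp: ldp_lower_bound_def)
    finally have "\<forall>\<^sub>F n in sequentially. ereal (- c) < ereal (1 / a n) * ln_ennreal (emeasure (\<mu> n) U)"
      by (rule less_LiminfD)
    then show "\<forall>\<^sub>F n in sequentially. ennreal (exp (- (a n * c))) \<le> emeasure (\<mu> n) U"
      by eventually_elim (use le_scaled_ln_iff[OF a_pos, of "- c"] in force)
  qed
next
  assume ?R
  show ?L
    unfolding ldp_lower_bound_def
  proof (intro allI impI)
    fix U :: "'a set"
    assume "open U"
    show "- (INF x\<in>U. enn2ereal (I x)) \<le> liminf (\<lambda>n. ereal (1 / a n) * ln_ennreal (emeasure (\<mu> n) U))"
      (is "_ \<le> ?l")
    proof (rule ccontr)
      assume "\<not> ?thesis"
      then have "(INF x\<in>U. enn2ereal (I x)) < - ?l"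
        by (metis ereal_minus_less_minus ereal_uminus_uminus not_le)
      then obtain c where c: "(INF x\<in>U. enn2ereal (I x)) < ereal c" "ereal c < - ?l"
        using ereal_dense2 by blast
      then obtain x where x: "x \<in> U" "enn2ereal (I x) < ereal c"
        by (auto simp: INF_less_iff)
      have "\<forall>\<^sub>F n in sequentially. ereal (- c) \<le> ereal (1 / a n) * ln_ennreal (emeasure (\<mu> n) U)"
        using \<open>?R\<close> \<open>open U\<close> x le_scaled_ln_iff[OF a_pos, of "- c"] by simp
      then have "ereal (- c) \<le> ?l"
        by (rule Liminf_bounded)
      then show False
        using c(2) by (metis ereal_less_uminus_reorder not_le uminus_ereal.simps(1))
    qed
  qed
qed

section \<open>Upper bounds for Gamma-limits\<close>

lemma gamma_limsup_lessD:
  assumes "gamma_limsup Z F z < c"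
  obtains s where "range s \<subseteq> topspace Z" "limitin Z s z sequentially"
    "\<forall>\<^sub>F n in sequentially. F n (s n) < c"
  using assms unfolding gamma_limsup_def INF_less_iff by (blast dest: Limsup_lessD)

text \<open>The diagonal argument. It is enough to realise the cost \<open>c\<close> inside each set \<open>T m\<close> separately,
from some index \<open>N m\<close> on; the sequence then uses \<open>T (M n)\<close> at time \<open>n\<close>, where \<open>M n\<close> is the largest
level already available. Since the sets \<open>T m\<close> eventually enter every neighbourhood of \<open>z\<close> and \<open>M\<close>
tends to infinity, the sequence converges to \<open>z\<close>.\<close>

lemma gamma_limsup_le_of_shrinking:
  assumes z: "z \<in> topspace Z"
    and T: "\<And>U. openin Z U \<Longrightarrow> z \<in> U \<Longrightarrow> \<forall>\<^sub>F m in sequentially. T m \<subseteq> U"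
    and ev: "\<And>m. \<forall>\<^sub>F n in sequentially. \<exists>s\<in>T m \<inter> topspace Z. F n s \<le> c"
  shows "gamma_limsup Z F z \<le> c"
proof -
  obtain N where N: "\<And>m n. N m \<le> n \<Longrightarrow> \<exists>s\<in>T m \<inter> topspace Z. F n s \<le> c"
    using ev unfolding eventually_sequentially by metis
  \<comment> \<open>The bound m \<le> n only keeps the set finite; 0 is a default for the times before any level is
    available.\<close>
  define M where "M n = Max (insert 0 {m. m \<le> n \<and> N m \<le> n})" for n
  have fin: "finite (insert 0 {m. m \<le> n \<and> N m \<le> n})" for n
    by simp
  have M_ge: "k \<le> M n" if "k \<le> n" "N k \<le> n" for k n
    unfolding M_def using that fin by (intro Max_ge) auto
  have M_lim: "filterlim M sequentially sequentially"
    unfolding filterlim_at_top eventually_sequentially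
    by (metis M_ge max.bounded_iff)
  have N_M: "\<forall>\<^sub>F n in sequentially. N (M n) \<le> n"
    using eventually_ge_at_top[of "max 1 (N 1)"]
  proof eventually_elim
    case (elim n)
    then have "M n \<noteq> 0"
      using M_ge[of 1 n] by auto
    moreover have "M n \<in> insert 0 {m. m \<le> n \<and> N m \<le> n}"
      unfolding M_def using fin by (rule Max_in) simp
    ultimately show ?case
      by simp
  qed
  define s where "s n = (if N (M n) \<le> n
      then SOME s. s \<in> T (M n) \<inter> topspace Z \<and> F n s \<le> c else z)" for n
  have s: "s n \<in> T (M n) \<inter> topspace Z \<and> F n (s n) \<le> c" if "N (M n) \<le> n" for n
    using someI_ex[of "\<lambda>s. s \<in> T (M n) \<inter> topspace Z \<and> F n s \<le> c"] N[OF that] that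
    unfolding s_def by auto
  have "range s \<subseteq> topspace Z"
    using s z unfolding s_def by (auto split: if_splits)
  moreover have "limitin Z s z sequentially"
    unfolding limitin_def
  proof (intro conjI allI impI z)
    fix U
    assume U: "openin Z U \<and> z \<in> U"
    have "\<forall>\<^sub>F n in sequentially. T (M n) \<subseteq> U"
      using T U M_lim by (auto dest: eventually_compose_filterlim)
    with N_M show "\<forall>\<^sub>F n in sequentially. s n \<in> U"
      by eventually_elim (use s in auto)
  qed
  moreover have "limsup (\<lambda>n. F n (s n)) \<le> c"
    using N_M by (intro Limsup_bounded) (auto elim!: eventually_mono dest: s)
  ultimately show ?thesis
    unfolding gamma_limsup_def by (intro INF_lower2[of s]) auto
qed

text \<open>Both topologies on measures and on compact sets are given by a subbase. Entering a set eventually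
is stable under finite intersections and passes to supersets, so it may be checked on the subbase.\<close>

lemma eventually_subset_generated_topology:
  assumes "openin (topology_generated_by S) U" "z \<in> U"
    and "\<And>B. B \<in> S \<Longrightarrow> z \<in> B \<Longrightarrow> eventually (\<lambda>m. T m \<subseteq> B) F"
  shows "eventually (\<lambda>m. T m \<subseteq> U) F"
proof -
  have "generate_topology_on S U"
    using assms(1) by (simp add: openin_topology_generated_by)
  then show ?thesis
    using assms(2)
  proof induction
    case (Int U V)
    then have "eventually (\<lambda>m. T m \<subseteq> U) F" "eventually (\<lambda>m. T m \<subseteq> V) F"
      by auto
    then show ?case
      by eventually_elim auto
  next
    case (UN K)
    then obtain V where V: "V \<in> K" "z \<in> V"
      by auto
    with UN have "eventually (\<lambda>m. T m \<subseteq> V) F"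
      by auto
    then show ?case
      by eventually_elim (use V in auto)
  qed (use assms(3) in auto)
qed

section \<open>Exponential integrals\<close>

lemma exp_ereal_mono: "x \<le> y \<Longrightarrow> exp_ereal x \<le> exp_ereal y"
  by (cases x; cases y) (auto simp: exp_ereal_def intro!: ennreal_leI)

lemma ereal_diff_leI:
  fixes e i l :: ereal
  assumes "\<bar>i\<bar> \<noteq> \<infinity>"
    and "\<And>b c. ereal b < e \<Longrightarrow> i < ereal c \<Longrightarrow> ereal (b - c) \<le> l"
  shows "e - i \<le> l"
proof (rule ccontr)
  assume "\<not> e - i \<le> l"
  then obtain t where t: "l < ereal t" "ereal t < e - i"
    using ereal_dense2 not_le by metis
  obtain r where r: "i = ereal r"
    using assms(1) by auto
  have "ereal (t + r) < e"
    using t(2) r by (cases e) auto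
  then obtain b where b: "ereal (t + r) < ereal b" "ereal b < e"
    using ereal_dense2 by blast
  have "ereal (b - (b - t)) \<le> l"
    using b r by (intro assms(2)) auto
  then show False
    using t(1) by simp
qed

text \<open>If \<open>\<phi>\<close> dropped to \<open>b\<close> or below at arbitrarily late times in every ball around \<open>x\<close>, then choosing
such points in balls of radius \<open>1 / Suc k\<close> at increasing times \<open>f k\<close>, and \<open>x\<close> itself at all other
times, would give a sequence converging to \<open>x\<close> along which the limit inferior is at most \<open>b\<close>.\<close>

lemma gamma_liminf_eventually_less:
  fixes x :: "'a::metric_space"
  assumes "ereal b < gamma_liminf euclidean \<phi> x"
  obtains U where "open U" "x \<in> U" "\<forall>\<^sub>F n in sequentially. \<forall>y\<in>U. ereal b < \<phi> n y"
proof (rule ccontr)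
  assume neg: "\<not> thesis"
  have ex: "\<exists>n\<ge>N. \<exists>y\<in>ball x (1 / Suc k). \<phi> n y \<le> ereal b" for N k
    using that[of "ball x (1 / Suc k)"] neg unfolding eventually_sequentially
    by (metis centre_in_ball not_less of_nat_0_less_iff open_ball zero_less_Suc zero_less_divide_1_iff)
  define P where "P n k \<longleftrightarrow> (\<exists>y\<in>ball x (1 / Suc k). \<phi> n y \<le> ereal b)" for n k
  have "\<exists>f. strict_mono f \<and> (\<forall>k. P (f k) k)"
  proof -
    have "\<exists>f. \<forall>k. P (f k) k \<and> f k < f (Suc k)"
    proof (rule dependent_nat_choice)
      show "\<exists>n. P n 0"
        using ex[of 0 0] by (auto simp: P_def)
      show "\<exists>m. P m (Suc k) \<and> n < m" for n k
        using ex[of "Suc n" "Suc k"] unfolding P_def Suc_le_eq by blast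
    qed
    then show ?thesis
      by (auto simp: strict_mono_Suc_iff)
  qed
  then obtain f where f: "strict_mono f" "\<And>k. P (f k) k"
    by blast
  then obtain y where y: "\<And>k. y k \<in> ball x (1 / Suc k)" "\<And>k. \<phi> (f k) (y k) \<le> ereal b"
    unfolding P_def by metis
  define s where "s n = (if n \<in> range f then y (inv f n) else x)" for n
  have s_f: "s (f k) = y k" for k
    using strict_mono_imp_inj_on[OF f(1)] by (simp add: s_def)
  have "s \<longlonglongrightarrow> x"
  proof (rule metric_LIMSEQ_I)
    fix e :: real
    assume "e > 0"
    then obtain k where k: "1 / Suc k < e"
      using nat_approx_posE by blast
    have "dist (s n) x < e" if "n \<ge> f k" for n
    proof (cases "n \<in> range f")
      case True
      then obtain j where j: "n = f j"
        by blast
      with that have "k \<le> j"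
        using strict_mono_less_eq[OF f(1)] by simp
      then have "1 / Suc j \<le> 1 / Suc k"
        by (simp add: frac_le)
      then show ?thesis
        using y(1)[of j] k j s_f by (simp add: dist_commute)
    qed (use \<open>e > 0\<close> s_def in auto)
    then show "\<exists>N. \<forall>n\<ge>N. dist (s n) x < e"
      by blast
  qed
  then have "gamma_liminf euclidean \<phi> x \<le> liminf (\<lambda>n. \<phi> n (s n))"
    unfolding gamma_liminf_def by (intro INF_lower) auto
  also have "\<dots> \<le> liminf ((\<lambda>n. \<phi> n (s n)) \<circ> f)"
    using f(1) by (rule liminf_subseq_mono)
  also have "\<dots> \<le> liminf (\<lambda>k. ereal b)"
    by (intro Liminf_mono) (auto simp: s_f y)
  finally show False
    using assms by (simp add: Liminf_const)
qed

text \<open>On a neighbourhood \<open>U\<close> where \<open>\<phi> n > b\<close> the integrand is at least \<open>exp (a n * b)\<close>, and \<open>U\<close> has mass at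
least \<open>exp (- a n * c)\<close>; the two exponents combine to \<open>b - c\<close>.\<close>

lemma exponential_integrals_of_ldp_lower_bound:
  fixes \<mu> :: "nat \<Rightarrow> 'a::metric_space measure"
  assumes a_pos: "\<And>n. a n > 0"
    and sets: "\<And>n. sets (\<mu> n) = sets borel"
    and ldp: "ldp_lower_bound \<mu> a I"
    and I: "I x \<noteq> \<infinity>"
    shows "gamma_liminf euclidean \<phi> x - enn2ereal (I x) \<le> liminf (\<lambda>n. ereal (1 / a n) *
               ln_ennreal (\<integral>\<^sup>+ x. exp_ereal (ereal (a n) * \<phi> n x) \<partial>\<mu> n))"
proof (rule ereal_diff_leI)
  show "\<bar>enn2ereal (I x)\<bar> \<noteq> \<infinity>"
    using I by (cases "I x") auto
next
  fix b c
  assume b: "ereal b < gamma_liminf euclidean \<phi> x" and c: "enn2ereal (I x) < ereal c"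
  obtain U where U: "open U" "x \<in> U" "\<forall>\<^sub>F n in sequentially. \<forall>y\<in>U. ereal b < \<phi> n y"
    using gamma_liminf_eventually_less[OF b] by blast
  have "\<forall>\<^sub>F n in sequentially. ennreal (exp (- (a n * c))) \<le> emeasure (\<mu> n) U"
    using ldp U c unfolding ldp_lower_bound_iff[of a, OF a_pos] by blast
  with U(3) have "\<forall>\<^sub>F n in sequentially. ereal (b - c) \<le> ereal (1 / a n) *
      ln_ennreal (\<integral>\<^sup>+ x. exp_ereal (ereal (a n) * \<phi> n x) \<partial>\<mu> n)"
  proof eventually_elim
    case (elim n)
    have le: "ennreal (exp (a n * b)) * indicator U y \<le> exp_ereal (ereal (a n) * \<phi> n y)" for y
    proof (cases "y \<in> U")
      case True
      then have "ereal (a n) * ereal b \<le> ereal (a n) * \<phi> n y"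
        using elim(1) a_pos[of n] by (intro ereal_mult_left_mono) (auto simp: less_imp_le)
      then show ?thesis
        using True exp_ereal_mono by (fastforce simp: exp_ereal_def)
    qed simp
    have "ennreal (exp (a n * (b - c))) = ennreal (exp (a n * b)) * ennreal (exp (- (a n * c)))"
      by (simp add: ennreal_mult[symmetric] exp_add[symmetric] algebra_simps)
    also have "\<dots> \<le> ennreal (exp (a n * b)) * emeasure (\<mu> n) U"
      using elim(2) by (rule mult_left_mono) simp
    also have "\<dots> = (\<integral>\<^sup>+ y. ennreal (exp (a n * b)) * indicator U y \<partial>\<mu> n)"
      using U(1) by (subst nn_integral_cmult_indicator) (auto simp: sets)
    also have "\<dots> \<le> (\<integral>\<^sup>+ y. exp_ereal (ereal (a n) * \<phi> n y) \<partial>\<mu> n)"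
      by (intro nn_integral_mono le)
    finally show ?case
      using le_scaled_ln_iff[OF a_pos[of n]] by blast
  qed
  then show "ereal (b - c) \<le> liminf (\<lambda>n. ereal (1 / a n) *
      ln_ennreal (\<integral>\<^sup>+ x. exp_ereal (ereal (a n) * \<phi> n x) \<partial>\<mu> n))"
    by (rule Liminf_bounded)
qed

text \<open>The mass of \<open>U\<close> is the exponential integral of the function with values \<open>0\<close> on \<open>U\<close> and \<open>-\<infinity>\<close>
off \<open>U\<close>; its Gamma-liminf is nonnegative on \<open>U\<close> because \<open>U\<close> is open.\<close>

lemma ldp_lower_bound_of_exponential_integrals:
  fixes \<mu> :: "nat \<Rightarrow> 'a::metric_space measure"
  assumes a_pos: "\<And>n. a n > 0"
    and sets: "\<And>n. sets (\<mu> n) = sets borel"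
    and P2: "\<And>(\<phi> :: nat \<Rightarrow> 'a \<Rightarrow> ereal) x. (\<And>n. \<phi> n \<in> borel_measurable borel) \<Longrightarrow> I x \<noteq> \<infinity> \<Longrightarrow>
        gamma_liminf euclidean \<phi> x - enn2ereal (I x) \<le> liminf (\<lambda>n. ereal (1 / a n) *
               ln_ennreal (\<integral>\<^sup>+ x. exp_ereal (ereal (a n) * \<phi> n x) \<partial>\<mu> n))"
  shows "ldp_lower_bound \<mu> a I"
  unfolding ldp_lower_bound_def
proof (intro allI impI)
  fix U :: "'a set"
  assume "open U"
  define \<phi> :: "nat \<Rightarrow> 'a \<Rightarrow> ereal" where "\<phi> n x = (if x \<in> U then 0 else -\<infinity>)" for n x
  have meas: "\<phi> n \<in> borel_measurable borel" for n
    unfolding \<phi>_def using \<open>open U\<close> by (intro measurable_If_set) auto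
  have "exp_ereal (ereal (a n) * \<phi> n x) = indicator U x" for n x
    using a_pos[of n] by (auto simp: exp_ereal_def \<phi>_def zero_ereal_def)
  then have int: "(\<integral>\<^sup>+ x. exp_ereal (ereal (a n) * \<phi> n x) \<partial>\<mu> n) = emeasure (\<mu> n) U" for n
    using \<open>open U\<close> by (simp add: sets)
  have "- enn2ereal (I x) \<le> liminf (\<lambda>n. ereal (1 / a n) * ln_ennreal (emeasure (\<mu> n) U))"
    if "x \<in> U" for x
  proof (cases "I x = \<infinity>")
    case False
    have "0 \<le> gamma_liminf euclidean \<phi> x"
      unfolding gamma_liminf_def
    proof (intro INF_greatest)
      fix s
      assume "s \<in> {s. range s \<subseteq> topspace euclidean \<and> limitin euclidean s x sequentially}"
      then have "s \<longlonglongrightarrow> x"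
        by simp
      then have "\<forall>\<^sub>F n in sequentially. s n \<in> U"
        using \<open>open U\<close> that by (rule topological_tendstoD)
      then show "0 \<le> liminf (\<lambda>n. \<phi> n (s n))"
        by (intro Liminf_bounded) (auto simp: \<phi>_def elim: eventually_mono)
    qed
    then have "0 - enn2ereal (I x) \<le> gamma_liminf euclidean \<phi> x - enn2ereal (I x)"
      by (intro ereal_minus_mono) auto
    also have "\<dots> \<le> liminf (\<lambda>n. ereal (1 / a n) * ln_ennreal (emeasure (\<mu> n) U))"
      using P2[of \<phi> x, OF meas False] by (simp add: int)
    finally show ?thesis
      by simp
  qed simp
  then have "- liminf (\<lambda>n. ereal (1 / a n) * ln_ennreal (emeasure (\<mu> n) U)) \<le> (INF x\<in>U. enn2ereal (I x))"
    using ereal_uminus_le_reorder by (intro INF_greatest) blast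
  then show "- (INF x\<in>U. enn2ereal (I x)) \<le>
      liminf (\<lambda>n. ereal (1 / a n) * ln_ennreal (emeasure (\<mu> n) U))"
    using ereal_uminus_le_reorder by blast
qed

section \<open>Entropy at Dirac masses\<close>

lemma borel_probsD:
  assumes "\<nu> \<in> borel_probs"
  shows "prob_space \<nu>" "sets \<nu> = sets borel" "space \<nu> = UNIV"
  using assms by (auto simp: space_prob_algebra dest: sets_eq_imp_space_eq)

lemma integrable_bounded_borel:
  fixes f :: "'a::topological_space \<Rightarrow> real"
  assumes "\<nu> \<in> borel_probs" "f \<in> borel_measurable borel" "\<And>x. \<bar>f x\<bar> \<le> B"
  shows "integrable \<nu> f"
proof -
  interpret prob_space \<nu>
    using assms(1) by (rule borel_probsD)
  show ?thesis
    using assms by (intro integrable_const_bound[of _ B])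
      (auto cong: measurable_cong_sets simp: borel_probsD)
qed

text \<open>The variational formula tested with \<open>t\<close> times the indicator of \<open>U\<close>. A large entropy is forced
when \<open>\<nu>\<close> gives substantial mass to \<open>U\<close> but \<open>exp t * measure \<mu> U\<close> stays bounded.\<close>

lemma relative_entropy_ge_test_set:
  fixes \<mu> :: "'a::topological_space measure"
  assumes \<nu>: "\<nu> \<in> borel_probs" and \<mu>: "\<mu> \<in> borel_probs" and U: "U \<in> sets borel"
  shows "ereal (t * measure \<nu> U - ln (1 + exp t * measure \<mu> U)) \<le> relative_entropy \<nu> \<mu>"
proof -
  interpret \<nu>: prob_space \<nu> using \<nu> by (rule borel_probsD)
  interpret \<mu>: prob_space \<mu> using \<mu> by (rule borel_probsD)
  note [simp] = borel_probsD(2,3)[OF \<nu>] borel_probsD(2,3)[OF \<mu>]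
  let ?\<phi> = "\<lambda>x. t * indicator U x :: real"
  let ?m = "measure \<mu> U"
  have "exp (?\<phi> x) = 1 + (exp t - 1) * indicator U x" for x
    by (simp split: split_indicator)
  then have "(\<integral>x. exp (?\<phi> x) \<partial>\<mu>) = (\<integral>x. 1 + (exp t - 1) * indicator U x \<partial>\<mu>)"
    by presburger
  also have "\<dots> = 1 + (exp t - 1) * ?m"
    using U by (subst Bochner_Integration.integral_add)
      (auto intro!: integrable_real_indicator simp: less_top[symmetric] \<mu>.prob_space[simplified])
  finally have int: "(\<integral>x. exp (?\<phi> x) \<partial>\<mu>) = (1 - ?m) + exp t * ?m"
    by (simp add: algebra_simps)
  have "?m \<le> 1"
    by simp
  then have "(1 - ?m) + exp t * ?m > 0"
    by (smt (verit) exp_gt_zero measure_nonneg mult_nonneg_nonneg mult_pos_pos)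
  then have "ln ((1 - ?m) + exp t * ?m) \<le> ln (1 + exp t * ?m)"
    by (intro ln_mono) auto
  moreover have "(\<integral>x. ?\<phi> x \<partial>\<nu>) = t * measure \<nu> U"
    using U by simp
  ultimately have "t * measure \<nu> U - ln (1 + exp t * ?m) \<le>
      (\<integral>x. ?\<phi> x \<partial>\<nu>) - ln (\<integral>x. exp (?\<phi> x) \<partial>\<mu>)"
    using int by simp
  moreover have "bounded (range ?\<phi>)"
    by (rule boundedI[of _ "\<bar>t\<bar>"]) (auto split: split_indicator)
  ultimately show ?thesis
    unfolding relative_entropy_def using U
    by (intro SUP_upper2[of ?\<phi>]) auto
qed

lemma limitin_narrow_integral:
  fixes f :: "'a::topological_space \<Rightarrow> real"
  assumes "limitin narrow_topology s \<nu> F" "f \<in> bcontfun"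
  shows "((\<lambda>n. \<integral>x. f x \<partial>s n) \<longlongrightarrow> (\<integral>x. f x \<partial>\<nu>)) F"
proof (rule topological_tendstoI)
  fix V :: "real set"
  assume V: "open V" "(\<integral>x. f x \<partial>\<nu>) \<in> V"
  have "openin narrow_topology {\<nu> \<in> borel_probs. (\<integral>x. f x \<partial>\<nu>) \<in> V}"
    unfolding narrow_topology_def using assms(2) V(1)
    by (intro topology_generated_by_Basis) blast
  moreover have "\<nu> \<in> borel_probs"
  proof -
    have "topspace narrow_topology \<subseteq> borel_probs"
      unfolding narrow_topology_def by (auto simp: topology_generated_by_topspace)
    then show ?thesis
      using assms(1) by (auto simp: limitin_def)
  qed
  ultimately have "\<forall>\<^sub>F n in F. s n \<in> {\<nu> \<in> borel_probs. (\<integral>x. f x \<partial>\<nu>) \<in> V}"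
    using assms(1) V(2) unfolding limitin_def by blast
  then show "\<forall>\<^sub>F n in F. (\<integral>x. f x \<partial>s n) \<in> V"
    by eventually_elim simp
qed

lemma topspace_narrow: "topspace narrow_topology = borel_probs"
proof -
  have "(\<lambda>_. 0) \<in> bcontfun"
    by (simp add: bcontfun_def)
  then have "borel_probs \<in> {{\<nu> \<in> borel_probs. (\<integral>x. f x \<partial>\<nu>) \<in> U} | f U. f \<in> (bcontfun :: ('a \<Rightarrow> real) set) \<and> open U}"
    by (force intro!: exI[of _ "UNIV :: real set"])
  then show ?thesis
    unfolding narrow_topology_def topology_generated_by_topspace by blast
qed

lemma return_in_borel_probs: "return borel x \<in> borel_probs"
  by (simp add: space_prob_algebra prob_space_return)

text \<open>A tent function below the indicator of \<open>U\<close>, equal to \<open>1\<close> at \<open>x\<close>, transfers narrow convergence to the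
mass of \<open>U\<close>.\<close>

lemma narrow_limit_return_mass:
  fixes x :: "'a::metric_space"
  assumes lim: "limitin narrow_topology s (return borel x) F"
    and s: "range s \<subseteq> borel_probs"
    and U: "open U" "x \<in> U" and \<theta>: "\<theta> < 1"
  shows "\<forall>\<^sub>F n in F. \<theta> < measure (s n) U"
proof -
  obtain r where r: "r > 0" "ball x r \<subseteq> U"
    using U openE by blast
  define f where "f y = max 0 (1 - dist x y / r)" for y
  have f: "0 \<le> f y" "f y \<le> indicator U y" for y
    using r by (auto simp: f_def divide_simps subset_eq split: split_indicator)
  have cont: "continuous_on UNIV f"
    unfolding f_def by (intro continuous_intros) (use r in auto)
  have bd: "\<bar>f y\<bar> \<le> 1" for y
    using f[of y] by (simp split: split_indicator_asm)
  then have "f \<in> bcontfun"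
    using cont by (auto simp: bcontfun_def intro!: boundedI[of _ 1])
  moreover have "(\<integral>y. f y \<partial>return borel x) = 1"
    using borel_measurable_continuous_onI[OF cont] by (subst integral_return) (auto simp: f_def)
  ultimately have "((\<lambda>n. \<integral>y. f y \<partial>s n) \<longlongrightarrow> 1) F"
    using limitin_narrow_integral[OF lim] by metis
  then have "\<forall>\<^sub>F n in F. \<theta> < (\<integral>y. f y \<partial>s n)"
    using \<theta> by (rule order_tendstoD)
  then show ?thesis
  proof eventually_elim
    case (elim n)
    have sn: "s n \<in> borel_probs"
      using s by auto
    then interpret prob_space "s n"
      by (rule borel_probsD)
    have "integrable (s n) f"
      using sn borel_measurable_continuous_onI[OF cont] bd by (rule integrable_bounded_borel)
    moreover have "integrable (s n) (indicat_real U)"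
      using U(1) borel_probsD[OF sn] by (intro integrable_real_indicator) (auto simp: less_top[symmetric])
    ultimately have "(\<integral>y. f y \<partial>s n) \<le> (\<integral>y. indicator U y \<partial>s n)"
      using f by (intro integral_mono) auto
    also have "\<dots> = measure (s n) U"
      using borel_probsD[OF sn] by simp
    finally show ?case
      using elim by simp
  qed
qed

text \<open>Let \<open>s n\<close> converge to the Dirac mass at \<open>x\<close> with scaled entropy below \<open>b < c\<close>. If \<open>\<mu> n\<close> gave \<open>U\<close>
mass below \<open>exp (- a n * c)\<close>, the test function with height \<open>t = a n * c\<close> on \<open>U\<close> would bound the
scaled entropy below by \<open>\<theta> * c - ln 2 / a n\<close>, where \<open>\<theta>\<close> is a lower bound for the mass of \<open>U\<close> under
\<open>s n\<close>. As that mass tends to \<open>1\<close>, \<open>\<theta>\<close> can be fixed with \<open>\<theta> * c > b\<close>; as \<open>a n\<close> tends to infinity,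
the bound eventually exceeds \<open>b\<close>.\<close>

lemma ldp_lower_bound_of_entropy_at_points:
  fixes \<mu> :: "nat \<Rightarrow> 'a::metric_space measure"
  assumes a_pos: "\<And>n. a n > 0"
    and a_lim: "filterlim a at_top sequentially"
    and mu: "\<And>n. \<mu> n \<in> borel_probs"
    and H1: "\<And>x. gamma_limsup narrow_topology (scaled_entropy a \<mu>) (return borel x) \<le> enn2ereal (I x)"
  shows "ldp_lower_bound \<mu> a I"
  unfolding ldp_lower_bound_iff[of a, OF a_pos]
proof (intro allI impI)
  fix U x c
  assume U: "open U" "x \<in> U" and "enn2ereal (I x) < ereal c"
  then obtain b where b: "enn2ereal (I x) < ereal b" "b < c"
    by (metis ereal_dense2 less_ereal.simps(1))
  have "0 \<le> enn2ereal (I x)"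
    by simp
  from this b(1) have "b > 0"
    by (metis ereal_less(2) le_less_trans)
  \<comment> \<open>With this choice \<theta> c lies midway between b and c, so \<theta> < 1 and \<theta> c > b.\<close>
  define \<theta> where "\<theta> = (b + c) / (2 * c)"
  have \<theta>: "\<theta> < 1" "\<theta> * c - b = (c - b) / 2"
    using b \<open>b > 0\<close> by (auto simp: \<theta>_def field_simps)
  have "gamma_limsup narrow_topology (scaled_entropy a \<mu>) (return borel x) < ereal b"
    using H1[of x] b(1) by (rule le_less_trans)
  then obtain s where s: "range s \<subseteq> borel_probs"
    "limitin narrow_topology s (return borel x) sequentially"
    "\<forall>\<^sub>F n in sequentially. scaled_entropy a \<mu> n (s n) < ereal b"
    unfolding topspace_narrow[symmetric] by (rule gamma_limsup_lessD)
  have "\<forall>\<^sub>F n in sequentially. 2 * ln 2 / (c - b) \<le> a n"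
    using a_lim by (simp add: filterlim_at_top)
  with s(3) narrow_limit_return_mass[OF s(2,1) U \<theta>(1)]
  show "\<forall>\<^sub>F n in sequentially. ennreal (exp (- (a n * c))) \<le> emeasure (\<mu> n) U"
  proof eventually_elim
    case (elim n)
    interpret prob_space "\<mu> n"
      using mu by (rule borel_probsD)
    have sn: "s n \<in> borel_probs"
      using s(1) by auto
    show ?case
    proof (rule ccontr)
      assume "\<not> ?case"
      then have small: "measure (\<mu> n) U \<le> exp (- (a n * c))"
        by (simp add: emeasure_eq_measure not_le ennreal_less_iff)
      have "exp (a n * c) * measure (\<mu> n) U \<le> 1"
        using mult_left_mono[OF small, of "exp (a n * c)"] by (simp add: exp_minus field_simps)
      then have "ln (1 + exp (a n * c) * measure (\<mu> n) U) \<le> ln 2"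
        by (intro ln_mono) (auto intro: add_pos_nonneg)
      moreover have "a n * c * \<theta> \<le> a n * c * measure (s n) U"
        using elim(2) a_pos[of n] b \<open>b > 0\<close> by (intro mult_left_mono) auto
      ultimately have "ereal (a n * c * \<theta> - ln 2) \<le>
          ereal (a n * c * measure (s n) U - ln (1 + exp (a n * c) * measure (\<mu> n) U))"
        by simp
      also have "\<dots> \<le> relative_entropy (s n) (\<mu> n)"
        using U by (intro relative_entropy_ge_test_set sn mu) auto
      finally have "ereal (1 / a n) * ereal (a n * c * \<theta> - ln 2) \<le> scaled_entropy a \<mu> n (s n)"
        unfolding scaled_entropy_def using a_pos[of n] by (intro ereal_mult_left_mono) auto
      then have "ereal (1 / a n * (a n * c * \<theta> - ln 2)) < ereal b"
        using elim(1) by (metis le_less_trans times_ereal.simps(1))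
      then have "a n * (c * \<theta> - b) < ln 2"
        using a_pos[of n] by (simp add: field_simps)
      then have "a n * (c - b) < 2 * ln 2"
        using \<theta>(2) by (simp add: mult.commute)
      then show False
        using elim(3) b(2) by (simp add: field_simps)
    qed
  qed
qed

section \<open>Mixtures of conditional laws\<close>

text \<open>The mixture with weights \<open>w i\<close> of the conditional laws of \<open>M\<close> given \<open>B i\<close>. Written as a single
density, it turns integrals into finite sums of conditional means, even when the \<open>B i\<close> overlap.\<close>

definition conditional_mixture ::
    "'a measure \<Rightarrow> 'i set \<Rightarrow> ('i \<Rightarrow> real) \<Rightarrow> ('i \<Rightarrow> 'a set) \<Rightarrow> 'a measure" where
  "conditional_mixture M J w B =
     density M (\<lambda>x. ennreal (\<Sum>i\<in>J. w i / measure M (B i) * indicator (B i) x))"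

definition conditional_mean :: "'a measure \<Rightarrow> 'a set \<Rightarrow> ('a \<Rightarrow> real) \<Rightarrow> real" where
  "conditional_mean M B f = (\<integral>x. indicator B x * f x \<partial>M) / measure M B"

lemma integrable_indicator_mult:
  fixes f :: "'a::topological_space \<Rightarrow> real"
  assumes "M \<in> borel_probs" "B \<in> sets borel" "f \<in> borel_measurable borel" "\<And>x. \<bar>f x\<bar> \<le> C"
  shows "integrable M (\<lambda>x. indicator B x * f x)"
proof (rule integrable_bounded_borel[OF assms(1)])
  show "\<bar>indicator B x * f x\<bar> \<le> C" for x
    using assms(4)[of x] by (auto simp: indicator_def)
qed (use assms in measurable)

lemma integral_indicator_borel:
  assumes "M \<in> borel_probs" "B \<in> sets borel"
  shows "(\<integral>x. indicator B x \<partial>M) = measure M B"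
  using assms by (simp add: borel_probsD)

lemma conditional_mean_near:
  fixes f :: "'a::topological_space \<Rightarrow> real"
  assumes M: "M \<in> borel_probs" and B: "B \<in> sets borel" "measure M B > 0"
    and f: "f \<in> borel_measurable borel" "\<And>x. \<bar>f x\<bar> \<le> C"
    and near: "\<And>z. z \<in> B \<Longrightarrow> \<bar>f z - v\<bar> \<le> k"
  shows "\<bar>conditional_mean M B f - v\<bar> \<le> k"
proof -
  note int = integrable_indicator_mult[OF M B(1)]
  have int_const: "integrable M (\<lambda>x. indicator B x * t)" for t :: real
    using int[of "\<lambda>_. t" "\<bar>t\<bar>"] by simp
  have const: "(\<integral>x. indicator B x * t \<partial>M) = measure M B * t" for t :: real
    using integral_indicator_borel[OF M B(1)] by simp
  have "(\<integral>x. indicator B x * f x \<partial>M) \<le> (\<integral>x. indicator B x * (v + k) \<partial>M)"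
    using near by (intro integral_mono int[OF f] int_const) (force split: split_indicator)
  moreover have "(\<integral>x. indicator B x * (v - k) \<partial>M) \<le> (\<integral>x. indicator B x * f x \<partial>M)"
    using near by (intro integral_mono int[OF f] int_const) (force split: split_indicator)
  ultimately show ?thesis
    unfolding const conditional_mean_def using B(2) by (simp add: abs_le_iff field_simps)
qed

text \<open>Jensen's inequality for the conditional law given \<open>B\<close>: it says that this law has entropy at most
\<open>- ln (measure M B)\<close> relative to \<open>M\<close>. The proof integrates over \<open>B\<close> the tangent to the exponential
at the mean value of \<open>f\<close>.\<close>

lemma conditional_mean_le_ln_integral_exp:
  fixes f :: "'a::topological_space \<Rightarrow> real"
  assumes M: "M \<in> borel_probs" and B: "B \<in> sets borel" "measure M B > 0"
    and f: "f \<in> borel_measurable borel" "\<And>x. \<bar>f x\<bar> \<le> C"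
  shows "conditional_mean M B f \<le> ln (\<integral>x. exp (f x) \<partial>M) - ln (measure M B)"
proof -
  define c where "c = conditional_mean M B f"
  note int = integrable_indicator_mult[OF M B(1)]
  have meas: "(\<lambda>x. exp (f x)) \<in> borel_measurable borel"
    using f(1) by measurable
  have "\<bar>exp (f x)\<bar> \<le> exp C" for x
    using f(2)[of x] by simp
  note int_exp = integrable_bounded_borel[OF M meas this]
  have int_const: "integrable M (\<lambda>x. indicator B x * t)" for t :: real
    using int[of "\<lambda>_. t" "\<bar>t\<bar>"] by simp
  have tangent: "exp c * (indicator B x * (1 - c)) + exp c * (indicator B x * f x) \<le> exp (f x)" for x
  proof -
    have "exp c * (1 + (f x - c)) \<le> exp c * exp (f x - c)"
      by (intro mult_left_mono exp_ge_add_one_self) simp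
    then show ?thesis
      by (auto simp: algebra_simps exp_add[symmetric] split: split_indicator)
  qed
  have "(\<integral>x. indicator B x * f x \<partial>M) = c * measure M B"
    using B(2) by (simp add: c_def conditional_mean_def)
  then have "exp c * measure M B = exp c * (\<integral>x. indicator B x * (1 - c) \<partial>M) + exp c * (\<integral>x. indicator B x * f x \<partial>M)"
    unfolding integral_mult_left_zero integral_indicator_borel[OF M B(1)] by (simp add: algebra_simps)
  also have "\<dots> = (\<integral>x. exp c * (indicator B x * (1 - c)) + exp c * (indicator B x * f x) \<partial>M)"
    by (subst Bochner_Integration.integral_add)
      (use int[OF f] int_const in \<open>auto intro!: integrable_mult_right simp del: integrable_mult_right_iff\<close>)
  also have "\<dots> \<le> (\<integral>x. exp (f x) \<partial>M)"
    using int[OF f] int_const int_exp tangent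
    by (intro integral_mono) (auto intro!: Bochner_Integration.integrable_add integrable_mult_right)
  finally have le: "exp c * measure M B \<le> (\<integral>x. exp (f x) \<partial>M)" .
  moreover have "0 < exp c * measure M B"
    using B(2) by simp
  ultimately have "ln (exp c * measure M B) \<le> ln (\<integral>x. exp (f x) \<partial>M)"
    by (intro ln_mono) linarith+
  then show ?thesis
    using B(2) by (simp add: ln_mult c_def)
qed

locale weighted_conditioning =
  fixes M :: "'a::topological_space measure" and J :: "'i set" and w :: "'i \<Rightarrow> real" and B :: "'i \<Rightarrow> 'a set"
  assumes reference_prob: "M \<in> borel_probs"
    and finite_index: "finite J"
    and weights: "\<And>i. i \<in> J \<Longrightarrow> 0 \<le> w i" "(\<Sum>i\<in>J. w i) = 1"
    and cells: "\<And>i. i \<in> J \<Longrightarrow> B i \<in> sets borel" "\<And>i. i \<in> J \<Longrightarrow> 0 < measure M (B i)"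
begin

lemma density_measurable:
  "(\<lambda>x. \<Sum>i\<in>J. w i / measure M (B i) * indicator (B i) x) \<in> borel_measurable M"
proof -
  have "indicat_real (B i) \<in> borel_measurable M" if "i \<in> J" for i
    using cells(1)[OF that] borel_probsD(2)[OF reference_prob] by (intro borel_measurable_indicator) simp
  then show ?thesis
    by (intro borel_measurable_sum borel_measurable_times borel_measurable_const)
qed

lemma integral_conditional_mixture:
  assumes f: "f \<in> borel_measurable borel" "\<And>x. \<bar>f x\<bar> \<le> C"
  shows "(\<integral>x. f x \<partial>conditional_mixture M J w B) = (\<Sum>i\<in>J. w i * conditional_mean M (B i) f)"
proof -
  let ?g = "\<lambda>x. \<Sum>i\<in>J. w i / measure M (B i) * indicator (B i) x"
  have sets: "sets M = sets borel"
    using reference_prob by (rule borel_probsD)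
  note g = density_measurable
  have "(\<integral>x. f x \<partial>conditional_mixture M J w B) = (\<integral>x. ?g x *\<^sub>R f x \<partial>M)"
    unfolding conditional_mixture_def
    using weights(1) f(1) sets by (intro integral_density g) (auto intro!: sum_nonneg cong: measurable_cong_sets)
  also have "\<dots> = (\<integral>x. (\<Sum>i\<in>J. w i / measure M (B i) * (indicator (B i) x * f x)) \<partial>M)"
    by (simp add: sum_distrib_right mult.assoc)
  also have "\<dots> = (\<Sum>i\<in>J. \<integral>x. w i / measure M (B i) * (indicator (B i) x * f x) \<partial>M)"
    using integrable_indicator_mult[OF reference_prob cells(1) f]
    by (intro Bochner_Integration.integral_sum integrable_mult_right) auto
  also have "\<dots> = (\<Sum>i\<in>J. w i * conditional_mean M (B i) f)"
    by (simp add: conditional_mean_def)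
  finally show ?thesis .
qed

text \<open>The total mass is the integral of the constant function \<open>1\<close>; that integral would be \<open>0\<close>, not \<open>1\<close>,
for a measure of infinite total mass.\<close>

lemma conditional_mixture_in_borel_probs: "conditional_mixture M J w B \<in> borel_probs"
proof -
  let ?N = "conditional_mixture M J w B"
  have N: "sets ?N = sets borel" "space ?N = UNIV"
    unfolding conditional_mixture_def using borel_probsD[OF reference_prob] by auto
  have "conditional_mean M (B i) (\<lambda>_. 1) = 1" if "i \<in> J" for i
    using cells[OF that] integral_indicator_borel[OF reference_prob] by (simp add: conditional_mean_def)
  then have "(\<integral>x. 1 \<partial>?N) = (1 :: real)"
    using weights(2) by (subst integral_conditional_mixture[of _ 1]) simp_all
  then have "measure ?N UNIV = 1"
    using N(2) by simp
  then have "emeasure ?N UNIV = 1"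
    by (metis emeasure_eq_ennreal_measure ennreal_1 enn2real_top measure_def zero_neq_one)
  then show ?thesis
    unfolding space_prob_algebra using N by (auto intro!: prob_spaceI)
qed

text \<open>Convexity of the entropy, visible directly in the variational formula: for a fixed test function
the integral is linear in the mixture and the logarithmic term is the same for all components.\<close>

lemma relative_entropy_conditional_mixture_le:
  "relative_entropy (conditional_mixture M J w B) M \<le> ereal (\<Sum>i\<in>J. w i * - ln (measure M (B i)))"
  unfolding relative_entropy_def
proof (intro SUP_least)
  fix \<phi> :: "'a \<Rightarrow> real"
  assume "\<phi> \<in> {\<phi> \<in> borel_measurable borel. bounded (range \<phi>)}"
  then obtain C where \<phi>: "\<phi> \<in> borel_measurable borel" "\<And>x. \<bar>\<phi> x\<bar> \<le> C"
    by (auto simp: bounded_iff)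
  let ?l = "ln (\<integral>x. exp (\<phi> x) \<partial>M)"
  have "(\<integral>x. \<phi> x \<partial>conditional_mixture M J w B) = (\<Sum>i\<in>J. w i * conditional_mean M (B i) \<phi>)"
    by (rule integral_conditional_mixture[OF \<phi>])
  also have "\<dots> \<le> (\<Sum>i\<in>J. w i * (?l - ln (measure M (B i))))"
    using weights cells by (intro sum_mono mult_left_mono conditional_mean_le_ln_integral_exp[OF reference_prob _ _ \<phi>]) auto
  also have "\<dots> = ?l + (\<Sum>i\<in>J. w i * - ln (measure M (B i)))"
    using weights(2) by (simp add: right_diff_distrib sum_subtractf sum_distrib_right[symmetric] sum_negf)
  finally show "ereal ((\<integral>x. \<phi> x \<partial>conditional_mixture M J w B) - ?l)
      \<le> ereal (\<Sum>i\<in>J. w i * - ln (measure M (B i)))"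
    by simp
qed

end

section \<open>Quantisation of a probability measure\<close>

text \<open>Otherwise integrating the reverse strict inequality over \<open>A\<close> would give \<open>t * m < m * t\<close>, where \<open>m\<close> is
the mass of \<open>A\<close> and \<open>t\<close> the integral of \<open>I\<close> over \<open>A\<close>. The inequality is kept in product form so
that no division of extended reals occurs.\<close>

lemma exists_point_below_average:
  assumes M: "finite_measure M" and A: "A \<in> sets M" "emeasure M A > 0" and I: "I \<in> borel_measurable M"
  shows "\<exists>x\<in>A. I x * emeasure M A \<le> (\<integral>\<^sup>+ y. I y * indicator A y \<partial>M)"
proof (rule ccontr)
  interpret finite_measure M
    by (rule M)
  let ?t = "\<integral>\<^sup>+ y. I y * indicator A y \<partial>M"
  assume "\<not> ?thesis"
  then have less: "?t < I x * emeasure M A" if "x \<in> A" for x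
    using that by (auto simp: not_le)
  have t: "?t < \<infinity>"
  proof -
    obtain x where "x \<in> A"
      using A(2) by fastforce
    then show ?thesis
      using less[of x] by (metis infinity_ennreal_def le_less_trans top_greatest less_top order.strict_iff_not)
  qed
  note [measurable] = A(1) I
  have "(\<integral>\<^sup>+ y. ?t * indicator A y \<partial>M) < (\<integral>\<^sup>+ y. emeasure M A * (I y * indicator A y) \<partial>M)"
  proof (rule nn_integral_less)
    show "(\<integral>\<^sup>+ y. ?t * indicator A y \<partial>M) \<noteq> \<infinity>"
      using A t by (simp add: nn_integral_cmult_indicator ennreal_mult_eq_top_iff)
    show "AE y in M. ?t * indicator A y \<le> emeasure M A * (I y * indicator A y)"
      using less by (intro AE_I2) (auto split: split_indicator simp: mult.commute less_imp_le)
    show "\<not> (AE y in M. emeasure M A * (I y * indicator A y) \<le> ?t * indicator A y)"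
    proof
      assume "AE y in M. emeasure M A * (I y * indicator A y) \<le> ?t * indicator A y"
      then have "AE y in M. y \<notin> A"
        by (rule AE_mp) (use less in \<open>auto intro!: AE_I2 simp: mult.commute not_le[symmetric] split: split_indicator_asm\<close>)
      then show False
        using A AE_iff_null_sets[OF A(1)] by auto
    qed
  qed measurable
  moreover have "(\<integral>\<^sup>+ y. emeasure M A * (I y * indicator A y) \<partial>M) = emeasure M A * ?t"
    by (rule nn_integral_cmult) measurable
  ultimately show False
    unfolding nn_integral_cmult_indicator[OF A(1)] by (simp add: mult.commute)
qed

text \<open>The cells come from a countable cover by balls of radius \<open>r\<close> around a dense sequence, made disjoint.
Finitely many of them carry mass more than \<open>\<theta>\<close>. The points \<open>x i\<close> are chosen inside the cells with
\<open>I (x i)\<close> at most the mean of \<open>I\<close>, so that, before renormalisation, the quantised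
measure costs no more than \<open>\<nu>\<close>.\<close>

lemma finite_quantization:
  fixes \<nu> :: "'a::{metric_space, second_countable_topology} measure"
  assumes \<nu>: "\<nu> \<in> borel_probs" and I: "I \<in> borel_measurable borel" and r: "r > 0" and \<theta>: "\<theta> < 1"
  obtains J :: "nat set" and A :: "nat \<Rightarrow> 'a set" and x :: "nat \<Rightarrow> 'a"
  where "finite J" "disjoint_family_on A J" "\<And>i. A i \<in> sets borel"
    "\<And>i. i \<in> J \<Longrightarrow> measure \<nu> (A i) > 0" "\<theta> < (\<Sum>i\<in>J. measure \<nu> (A i))"
    "\<And>i. i \<in> J \<Longrightarrow> A i \<subseteq> ball (x i) (2 * r)"
    "\<And>i. i \<in> J \<Longrightarrow> I (x i) * emeasure \<nu> (A i) \<le> (\<integral>\<^sup>+ y. I y * indicator (A i) y \<partial>\<nu>)"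
proof -
  interpret prob_space \<nu>
    using \<nu> by (rule borel_probsD)
  have sets: "sets \<nu> = sets borel" and space: "space \<nu> = UNIV"
    using borel_probsD[OF \<nu>] by auto
  obtain D :: "'a set" where D: "countable D" "\<And>X. open X \<Longrightarrow> X \<noteq> {} \<Longrightarrow> \<exists>d\<in>D. d \<in> X"
    using countable_dense_setE by blast
  define e where "e = from_nat_into D"
  define A where "A = disjointed (\<lambda>i. ball (e i) r)"
  have A_sets: "A i \<in> sets borel" for i
    unfolding A_def disjointed_def by auto
  have A_sub: "A i \<subseteq> ball (e i) r" for i
    unfolding A_def by (rule disjointed_subset)
  have disj: "disjoint_family A"
    unfolding A_def by (rule disjoint_family_disjointed)
  have "\<exists>i. y \<in> ball (e i) r" for y
  proof -
    obtain d where d: "d \<in> D" "d \<in> ball y r"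
      using D(2)[of "ball y r"] r by auto
    then obtain i where "e i = d"
      using D(1) unfolding e_def by (metis empty_iff from_nat_into_surj)
    then show ?thesis
      using d by (auto simp: dist_commute)
  qed
  then have "(\<Union>i. A i) = UNIV"
    unfolding A_def UN_disjointed_eq by auto
  then have "(\<lambda>i. measure \<nu> (A i)) sums 1"
    using finite_measure_UNION[of A] A_sets disj sets prob_space space by (simp add: image_subset_iff)
  then have "(\<lambda>N. \<Sum>i<N. measure \<nu> (A i)) \<longlonglongrightarrow> 1"
    by (simp add: sums_def)
  from order_tendstoD(1)[OF this \<theta>] obtain N where N: "\<theta> < (\<Sum>i<N. measure \<nu> (A i))"
    by (auto simp: eventually_sequentially)
  define J where "J = {i. i < N \<and> measure \<nu> (A i) > 0}"
  have "\<exists>x\<in>A i. I x * emeasure \<nu> (A i) \<le> (\<integral>\<^sup>+ y. I y * indicator (A i) y \<partial>\<nu>)" if "i \<in> J" for i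
    using that A_sets sets I
    by (intro exists_point_below_average) (auto simp: J_def emeasure_eq_measure finite_measure_axioms cong: measurable_cong_sets)
  then obtain x where x: "\<And>i. i \<in> J \<Longrightarrow> x i \<in> A i"
    "\<And>i. i \<in> J \<Longrightarrow> I (x i) * emeasure \<nu> (A i) \<le> (\<integral>\<^sup>+ y. I y * indicator (A i) y \<partial>\<nu>)"
    by metis
  show ?thesis
  proof (rule that)
    show "finite J"
      by (simp add: J_def)
    show "disjoint_family_on A J"
      using disj by (rule disjoint_family_on_mono[rotated]) simp
    have "(\<Sum>i\<in>J. measure \<nu> (A i)) = (\<Sum>i<N. measure \<nu> (A i))"
      by (rule sum.mono_neutral_left) (auto simp: J_def zero_less_measure_iff not_less measure_le_0_iff)
    then show "\<theta> < (\<Sum>i\<in>J. measure \<nu> (A i))"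
      using N by simp
    show "A i \<subseteq> ball (x i) (2 * r)" if "i \<in> J" for i
    proof
      fix y
      assume "y \<in> A i"
      then have "dist (e i) y < r" "dist (e i) (x i) < r"
        using A_sub[of i] x(1)[OF that] by auto
      then show "y \<in> ball (x i) (2 * r)"
        using dist_triangle3[of "x i" y "e i"] by simp
    qed
  qed (use A_sets x J_def in auto)
qed

section \<open>Approximation in the narrow topology\<close>

lemma abs_integral_le_integral:
  fixes f g :: "'a \<Rightarrow> real"
  assumes "integrable M f" "integrable M g" "\<And>x. \<bar>f x\<bar> \<le> g x"
  shows "\<bar>\<integral>x. f x \<partial>M\<bar> \<le> (\<integral>x. g x \<partial>M)"
  using assms by (intro order_trans[OF integral_abs_bound integral_mono]) auto

text \<open>Comparing \<open>\<nu>\<close> with a mixture of laws on small balls requires control of \<open>f\<close> at small scales. A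
bounded continuous \<open>f\<close> need not be uniformly continuous, but its oscillation at scale \<open>r\<close> tends to
\<open>0\<close> pointwise and boundedly as \<open>r\<close> tends to \<open>0\<close>, which is enough after integration against \<open>\<nu>\<close>.\<close>

definition oscillation :: "('a::metric_space \<Rightarrow> real) \<Rightarrow> real \<Rightarrow> 'a \<Rightarrow> real" where
  "oscillation f r y = (SUP z\<in>ball y r. \<bar>f z - f y\<bar>)"

context
  fixes f :: "'a::metric_space \<Rightarrow> real" and C :: real
  assumes bounded: "\<And>x. \<bar>f x\<bar> \<le> C"
begin

lemma diff_le_twice_bound: "\<bar>f z - f y\<bar> \<le> 2 * C"
  using bounded[of y] bounded[of z] by linarith

lemma bdd_above_oscillation: "bdd_above ((\<lambda>z. \<bar>f z - f y\<bar>) ` A)"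
  by (rule bdd_aboveI2[OF diff_le_twice_bound])

lemma diff_le_oscillation: "dist y z < r \<Longrightarrow> \<bar>f z - f y\<bar> \<le> oscillation f r y"
  unfolding oscillation_def by (rule cSUP_upper[OF _ bdd_above_oscillation]) simp

lemma oscillation_leI:
  assumes "r > 0" "\<And>z. dist y z < r \<Longrightarrow> \<bar>f z - f y\<bar> \<le> e"
  shows "oscillation f r y \<le> e"
  unfolding oscillation_def using assms by (intro cSUP_least) auto

lemma oscillation_bounds:
  assumes "r > 0"
  shows "0 \<le> oscillation f r y" "\<bar>oscillation f r y\<bar> \<le> 2 * C"
proof -
  show nonneg: "0 \<le> oscillation f r y"
    using diff_le_oscillation[of y y r] assms by simp
  show "\<bar>oscillation f r y\<bar> \<le> 2 * C"
    using nonneg oscillation_leI[OF assms diff_le_twice_bound] by simp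
qed

text \<open>The oscillation is lower semicontinuous: a single point \<open>z\<close> witnessing that it exceeds \<open>c\<close> at \<open>y\<close> does
so for all nearby \<open>y\<close>.\<close>

lemma borel_measurable_oscillation:
  assumes "continuous_on UNIV f" "r > 0"
  shows "oscillation f r \<in> borel_measurable borel"
proof -
  have "open {y. c < oscillation f r y}" for c
  proof -
    have "{y. c < oscillation f r y} = (\<Union>z. {y. dist y z < r} \<inter> {y. c < \<bar>f z - f y\<bar>})"
      unfolding oscillation_def
      using assms(2) by (subst less_cSUP_iff[OF _ bdd_above_oscillation]) auto
    moreover have "open ({y. dist y z < r} \<inter> {y. c < \<bar>f z - f y\<bar>})" for z
      by (intro open_Int open_Collect_less continuous_intros assms(1))
    ultimately show ?thesis
      by auto
  qed
  then show ?thesis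
    by (subst borel_measurable_iff_greater) auto
qed

lemma oscillation_tendsto_0:
  assumes "continuous_on UNIV f" and r: "r \<longlonglongrightarrow> 0" "\<And>n. r n > 0"
  shows "(\<lambda>n. oscillation f (r n) y) \<longlonglongrightarrow> 0"
proof (rule LIMSEQ_I)
  fix e :: real
  assume e: "e > 0"
  have "isCont f y"
    using assms(1) by (simp add: continuous_on_eq_continuous_at)
  then obtain s where s: "s > 0" "\<And>z. dist z y < s \<Longrightarrow> dist (f z) (f y) < e / 2"
    using e unfolding continuous_at_eps_delta by (metis half_gt_zero)
  obtain N where N: "\<And>n. n \<ge> N \<Longrightarrow> r n < s"
    using order_tendstoD(2)[OF r(1) s(1)] by (auto simp: eventually_sequentially)
  have "oscillation f (r n) y \<le> e / 2" if "n \<ge> N" for n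
  proof (rule oscillation_leI[OF r(2)])
    show "\<bar>f z - f y\<bar> \<le> e / 2" if "dist y z < r n" for z
      using s(2)[of z] N[OF \<open>n \<ge> N\<close>] that by (simp add: dist_real_def dist_commute)
  qed
  then show "\<exists>N. \<forall>n\<ge>N. norm (oscillation f (r n) y - 0) < e"
    using oscillation_bounds(1)[OF r(2)] e by (intro exI[of _ N]) force
qed

lemma integral_oscillation_tendsto_0:
  assumes \<nu>: "\<nu> \<in> borel_probs" and f: "continuous_on UNIV f" and r: "r \<longlonglongrightarrow> 0" "\<And>n. r n > 0"
  shows "(\<lambda>n. \<integral>y. oscillation f (r n) y \<partial>\<nu>) \<longlonglongrightarrow> 0"
proof -
  have sets: "sets \<nu> = sets borel"
    using \<nu> by (rule borel_probsD)
  have "(\<lambda>n. \<integral>y. oscillation f (r n) y \<partial>\<nu>) \<longlonglongrightarrow> (\<integral>y. 0 \<partial>\<nu>)"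
  proof (rule integral_dominated_convergence[where w = "\<lambda>_. 2 * C"])
    show "oscillation f (r n) \<in> borel_measurable \<nu>" for n
      using borel_measurable_oscillation[OF f r(2)] sets by (simp cong: measurable_cong_sets)
    show "integrable \<nu> (\<lambda>_. 2 * C)"
      by (rule integrable_bounded_borel[OF \<nu>, of _ "\<bar>2 * C\<bar>"]) auto
    show "AE y in \<nu>. (\<lambda>n. oscillation f (r n) y) \<longlonglongrightarrow> 0"
      using oscillation_tendsto_0[OF f r] by simp
    show "AE y in \<nu>. norm (oscillation f (r n) y) \<le> 2 * C" for n
      using oscillation_bounds(2)[OF r(2)] by simp
  qed simp
  then show ?thesis
    by simp
qed

end

text \<open>The measures that approximate \<open>\<nu>\<close> at scale \<open>r\<close>, by an error bound that is explicit in the test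
function and does not depend on the measure. The first term accounts for moving mass by at most
\<open>3 * r\<close>, the second for replacing mass \<open>r\<close> arbitrarily.\<close>

definition approximations_at_scale :: "'a::metric_space measure \<Rightarrow> real \<Rightarrow> 'a measure set" where
  "approximations_at_scale \<nu> r = {s \<in> borel_probs. \<forall>f C. continuous_on UNIV f \<longrightarrow> (\<forall>x. \<bar>f x\<bar> \<le> C) \<longrightarrow>
     \<bar>(\<integral>x. f x \<partial>s) - (\<integral>x. f x \<partial>\<nu>)\<bar> \<le> (\<integral>y. oscillation f (3 * r) y \<partial>\<nu>) + 2 * C * r}"

lemma approximations_enter_narrow_nbhds:
  fixes \<nu> :: "'a::metric_space measure"
  assumes U: "openin narrow_topology U" "\<nu> \<in> U" and r: "r \<longlonglongrightarrow> 0" "\<And>n. r n > 0"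
  shows "\<forall>\<^sub>F m in sequentially. approximations_at_scale \<nu> (r m) \<subseteq> U"
proof (rule eventually_subset_generated_topology)
  show "openin (topology_generated_by
     {{\<nu> \<in> borel_probs. (\<integral>x. f x \<partial>\<nu>) \<in> U} | f U. f \<in> (bcontfun :: ('a \<Rightarrow> real) set) \<and> open U}) U"
    using U(1) by (simp add: narrow_topology_def)
next
  fix B
  assume "B \<in> {{\<nu> \<in> borel_probs. (\<integral>x. f x \<partial>\<nu>) \<in> U} | f U. f \<in> (bcontfun :: ('a \<Rightarrow> real) set) \<and> open U}"
    and "\<nu> \<in> B"
  then obtain f :: "'a \<Rightarrow> real" and V where B: "B = {\<nu> \<in> borel_probs. (\<integral>x. f x \<partial>\<nu>) \<in> V}"
    and f: "f \<in> bcontfun" and V: "open V" "(\<integral>x. f x \<partial>\<nu>) \<in> V" and \<nu>: "\<nu> \<in> borel_probs"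
    by auto
  obtain e where e: "e > 0" "\<And>v. \<bar>v - (\<integral>x. f x \<partial>\<nu>)\<bar> < e \<Longrightarrow> v \<in> V"
    using V unfolding open_dist dist_real_def by blast
  obtain C where C: "\<And>x. \<bar>f x\<bar> \<le> C"
    using f by (auto simp: bcontfun_def bounded_iff)
  have cont: "continuous_on UNIV f"
    using f by (simp add: bcontfun_def)
  have "(\<lambda>m. 3 * r m) \<longlonglongrightarrow> 0"
    using tendsto_mult_left[OF r(1), of 3] by simp
  then have "(\<lambda>m. \<integral>y. oscillation f (3 * r m) y \<partial>\<nu>) \<longlonglongrightarrow> 0"
    using r(2) by (intro integral_oscillation_tendsto_0[of f C, OF C \<nu> cont]) auto
  moreover have "(\<lambda>m. 2 * C * r m) \<longlonglongrightarrow> 0"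
    using tendsto_mult_left[OF r(1), of "2 * C"] by simp
  ultimately have "(\<lambda>m. (\<integral>y. oscillation f (3 * r m) y \<partial>\<nu>) + 2 * C * r m) \<longlonglongrightarrow> 0"
    using tendsto_add by fastforce
  then have "\<forall>\<^sub>F m in sequentially. (\<integral>y. oscillation f (3 * r m) y \<partial>\<nu>) + 2 * C * r m < e"
    using e(1) by (rule order_tendstoD)
  then show "\<forall>\<^sub>F m in sequentially. approximations_at_scale \<nu> (r m) \<subseteq> B"
  proof eventually_elim
    case (elim m)
    show ?case
    proof
      fix s
      assume s: "s \<in> approximations_at_scale \<nu> (r m)"
      then have "\<bar>(\<integral>x. f x \<partial>s) - (\<integral>x. f x \<partial>\<nu>)\<bar> \<le> (\<integral>y. oscillation f (3 * r m) y \<partial>\<nu>) + 2 * C * r m"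
        using cont C unfolding approximations_at_scale_def by blast
      then have "(\<integral>x. f x \<partial>s) \<in> V"
        using elim by (intro e(2)) linarith
      then show "s \<in> B"
        using s by (simp add: B approximations_at_scale_def)
    qed
  qed
qed (rule U)

text \<open>A point of the cell \<open>A i\<close> and a point of \<open>ball (x i) r\<close> are at distance less than \<open>3 * r\<close>, so on each
cell the mean of \<open>f\<close> over the ball differs from \<open>f\<close> by at most the oscillation. The normalisation
by \<open>p\<close> and the mass of \<open>\<nu>\<close> outside the cells each contribute at most \<open>C * r\<close>.\<close>

lemma conditional_mixture_is_approximation:
  fixes \<nu> M :: "'a::metric_space measure"
  assumes \<nu>: "\<nu> \<in> borel_probs" and M: "M \<in> borel_probs" and r: "r > 0"
    and J: "finite J" "J \<noteq> {}" "disjoint_family_on A J" "\<And>i. A i \<in> sets borel"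
    and pos: "\<And>i. i \<in> J \<Longrightarrow> measure \<nu> (A i) > 0"
    and p: "p = (\<Sum>i\<in>J. measure \<nu> (A i))" "1 - r \<le> p"
    and sub: "\<And>i. i \<in> J \<Longrightarrow> A i \<subseteq> ball (x i) (2 * r)"
    and B: "\<And>i. i \<in> J \<Longrightarrow> 0 < measure M (ball (x i) r)"
  shows "conditional_mixture M J (\<lambda>i. measure \<nu> (A i) / p) (\<lambda>i. ball (x i) r) \<in> approximations_at_scale \<nu> r"
    (is "?s \<in> _")
proof -
  interpret \<nu>: prob_space \<nu>
    using \<nu> by (rule borel_probsD)
  have p_pos: "p > 0"
    unfolding p(1) using J pos by (intro sum_pos) auto
  interpret weighted_conditioning M J "\<lambda>i. measure \<nu> (A i) / p" "\<lambda>i. ball (x i) r"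
    using M J B p_pos by unfold_locales (auto simp: p(1) sum_divide_distrib[symmetric])
  let ?U = "\<Union>i\<in>J. A i"
  have U: "?U \<in> sets borel" "measure \<nu> ?U = p" "\<And>y. indicat_real ?U y = (\<Sum>i\<in>J. indicator (A i) y)"
  proof -
    show "?U \<in> sets borel"
      using J(1,4) by (intro sets.finite_UN) auto
    show "measure \<nu> ?U = p"
      unfolding p(1) using J borel_probsD[OF \<nu>] by (intro \<nu>.finite_measure_finite_Union) auto
    show "indicat_real ?U y = (\<Sum>i\<in>J. indicator (A i) y)" for y
      using indicator_UN_disjoint[OF J(1,3)] .
  qed
  have p_le: "p \<le> 1"
    using U(2) \<nu>.prob_le_1[of ?U] by simp
  have "\<bar>(\<integral>y. f y \<partial>?s) - (\<integral>y. f y \<partial>\<nu>)\<bar> \<le> (\<integral>y. oscillation f (3 * r) y \<partial>\<nu>) + 2 * C * r"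
    if cont: "continuous_on UNIV f" and C: "\<And>y. \<bar>f y\<bar> \<le> C" for f C
  proof -
    let ?g = "oscillation f (3 * r)"
    let ?avg = "\<lambda>i. conditional_mean M (ball (x i) r) f"
    have f: "f \<in> borel_measurable borel"
      using cont by (rule borel_measurable_continuous_onI)
    have g: "?g \<in> borel_measurable borel" "\<And>y. \<bar>?g y\<bar> \<le> 2 * C" "\<And>y. 0 \<le> ?g y"
      using borel_measurable_oscillation[of f C, OF C cont] oscillation_bounds[of f C, OF C] r by simp_all
    note int_f = integrable_bounded_borel[OF \<nu> f C] and int_g = integrable_bounded_borel[OF \<nu> g(1,2)]
    note int_Uf = integrable_indicator_mult[OF \<nu> _ f C] and int_Ug = integrable_indicator_mult[OF \<nu> _ g(1,2)]
    have int_ind: "integrable \<nu> (\<lambda>y. indicator A y * t)" if "A \<in> sets borel" for A and t :: real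
      using integrable_indicator_mult[OF \<nu> that, of "\<lambda>_. t" "\<bar>t\<bar>"] by simp
    have C_nonneg: "0 \<le> C"
      using C[of undefined] by linarith
    have s_eq: "p * (\<integral>y. f y \<partial>?s) = (\<Sum>i\<in>J. measure \<nu> (A i) * ?avg i)"
      unfolding integral_conditional_mixture[OF f C] using p_pos
      by (simp add: sum_distrib_left)
    have piece: "\<bar>measure \<nu> (A i) * ?avg i - (\<integral>y. indicator (A i) y * f y \<partial>\<nu>)\<bar> \<le>
        (\<integral>y. indicator (A i) y * ?g y \<partial>\<nu>)" if i: "i \<in> J" for i
    proof -
      have near: "\<bar>?avg i - f y\<bar> \<le> ?g y" if y: "y \<in> A i" for y
      proof (rule conditional_mean_near[OF M _ B[OF i] f C])
        fix z
        assume "z \<in> ball (x i) r"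
        then have "dist y z < 3 * r"
          using sub[OF i] y dist_triangle3[of y z "x i"] by fastforce
        then show "\<bar>f z - f y\<bar> \<le> ?g y"
          by (rule diff_le_oscillation[of f C, OF C])
      qed simp
      have "measure \<nu> (A i) * ?avg i = (\<integral>y. indicator (A i) y * ?avg i \<partial>\<nu>)"
        using integral_indicator_borel[OF \<nu> J(4)] by simp
      then have "\<bar>measure \<nu> (A i) * ?avg i - (\<integral>y. indicator (A i) y * f y \<partial>\<nu>)\<bar> =
          \<bar>\<integral>y. indicator (A i) y * ?avg i - indicator (A i) y * f y \<partial>\<nu>\<bar>"
        by (simp only: Bochner_Integration.integral_diff[OF int_ind[OF J(4)] int_Uf[OF J(4)]])
      also have "\<dots> \<le> (\<integral>y. indicator (A i) y * ?g y \<partial>\<nu>)"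
      proof (rule abs_integral_le_integral)
        show "\<bar>indicator (A i) y * ?avg i - indicator (A i) y * f y\<bar> \<le> indicator (A i) y * ?g y" for y
          using near by (simp split: split_indicator)
      qed (intro Bochner_Integration.integrable_diff int_ind int_Uf int_Ug J(4))+
      finally show ?thesis .
    qed
    have U_f: "(\<integral>y. indicator ?U y * f y \<partial>\<nu>) = (\<Sum>i\<in>J. \<integral>y. indicator (A i) y * f y \<partial>\<nu>)"
      unfolding U(3) sum_distrib_right using int_Uf[OF J(4)] by (intro Bochner_Integration.integral_sum)
    have U_g: "(\<integral>y. indicator ?U y * ?g y \<partial>\<nu>) = (\<Sum>i\<in>J. \<integral>y. indicator (A i) y * ?g y \<partial>\<nu>)"
      unfolding U(3) sum_distrib_right using int_Ug[OF J(4)] by (intro Bochner_Integration.integral_sum)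
    have "\<bar>p * (\<integral>y. f y \<partial>?s) - (\<integral>y. indicator ?U y * f y \<partial>\<nu>)\<bar> \<le> (\<integral>y. indicator ?U y * ?g y \<partial>\<nu>)"
      unfolding s_eq U_f U_g sum_subtractf[symmetric]
      by (rule order_trans[OF sum_abs sum_mono[OF piece]])
    also have "\<dots> \<le> (\<integral>y. ?g y \<partial>\<nu>)"
      using g(3) by (intro integral_mono int_Ug U(1) int_g) (auto split: split_indicator)
    finally have main: "\<bar>p * (\<integral>y. f y \<partial>?s) - (\<integral>y. indicator ?U y * f y \<partial>\<nu>)\<bar> \<le> (\<integral>y. ?g y \<partial>\<nu>)" .
    have "\<bar>(\<integral>y. f y \<partial>\<nu>) - (\<integral>y. indicator ?U y * f y \<partial>\<nu>)\<bar> =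
        \<bar>\<integral>y. f y - indicator ?U y * f y \<partial>\<nu>\<bar>"
      using int_f int_Uf[OF U(1)] by simp
    also have "\<dots> \<le> (\<integral>y. C - indicator ?U y * C \<partial>\<nu>)"
    proof (rule abs_integral_le_integral)
      have "integrable \<nu> (\<lambda>_. C)"
        using int_ind[of UNIV C] by simp
      then show "integrable \<nu> (\<lambda>y. C - indicator ?U y * C)"
        by (intro Bochner_Integration.integrable_diff int_ind U(1))
      show "\<bar>f y - indicator ?U y * f y\<bar> \<le> C - indicator ?U y * C" for y
        using C[of y] C_nonneg by (simp split: split_indicator)
    qed (intro Bochner_Integration.integrable_diff int_f int_Uf U(1))
    also have "\<dots> = C * (1 - p)"
      using int_ind[OF U(1)] integral_indicator_borel[OF \<nu> U(1)] U(2) \<nu>.prob_space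
      by (simp add: algebra_simps)
    also have "\<dots> \<le> C * r"
      using p(2) C_nonneg by (intro mult_left_mono) auto
    finally have rest: "\<bar>(\<integral>y. f y \<partial>\<nu>) - (\<integral>y. indicator ?U y * f y \<partial>\<nu>)\<bar> \<le> C * r" .
    have "\<bar>\<integral>y. f y \<partial>?s\<bar> \<le> C"
    proof -
      have "\<bar>?avg i\<bar> \<le> C" if "i \<in> J" for i
        using conditional_mean_near[OF M _ B[OF that] f C, of 0 C] C by simp
      then have "(\<Sum>i\<in>J. \<bar>measure \<nu> (A i) / p * ?avg i\<bar>) \<le> (\<Sum>i\<in>J. measure \<nu> (A i) / p * C)"
        using p_pos by (intro sum_mono) (auto simp: abs_mult intro!: mult_left_mono divide_right_mono)
      also have "\<dots> = C"
        unfolding sum_distrib_right[symmetric] weights(2) by simp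
      finally show ?thesis
        unfolding integral_conditional_mixture[OF f C] by (rule order_trans[OF sum_abs])
    qed
    then have "(1 - p) * \<bar>\<integral>y. f y \<partial>?s\<bar> \<le> r * C"
      using p(2) p_le C_nonneg r by (intro mult_mono) auto
    moreover have "(1 - p) * \<bar>\<integral>y. f y \<partial>?s\<bar> = \<bar>(1 - p) * (\<integral>y. f y \<partial>?s)\<bar>"
      using p_le by (simp add: abs_mult)
    moreover have "(1 - p) * (\<integral>y. f y \<partial>?s) = (\<integral>y. f y \<partial>?s) - p * (\<integral>y. f y \<partial>?s)"
      by (simp add: left_diff_distrib)
    ultimately show ?thesis
      using main rest by (simp only: mult.commute[of r C])
  qed
  then show ?thesis
    unfolding approximations_at_scale_def using conditional_mixture_in_borel_probs by blast
qed

section \<open>Recovery sequences for the entropy\<close>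

text \<open>The weights are those of the cells, renormalised by their total mass \<open>p\<close>. The weighted sum of the
values \<open>I (x i)\<close> is at most \<open>\<nu>(I) / p\<close>, which is at most some \<open>b < c\<close> once \<open>p\<close> is close to \<open>1\<close>; the
finitely many balls eventually satisfy the lower bound with the margin \<open>c - b\<close>.\<close>

lemma entropy_recovery_of_ldp_lower_bound:
  fixes \<mu> :: "nat \<Rightarrow> 'a::{metric_space, second_countable_topology} measure"
  assumes a_pos: "\<And>n. a n > 0"
    and mu: "\<And>n. \<mu> n \<in> borel_probs"
    and I: "I \<in> borel_measurable borel"
    and ldp: "ldp_lower_bound \<mu> a I"
    and \<nu>: "\<nu> \<in> borel_probs"
    and c: "enn2ereal (\<integral>\<^sup>+ x. I x \<partial>\<nu>) < ereal c"
    and r: "r > 0"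
  shows "\<forall>\<^sub>F n in sequentially. \<exists>s\<in>approximations_at_scale \<nu> r. scaled_entropy a \<mu> n s \<le> ereal c"
proof -
  interpret \<nu>: prob_space \<nu>
    using \<nu> by (rule borel_probsD)
  have sets: "sets \<nu> = sets borel"
    using \<nu> by (rule borel_probsD)
  define E where "E = enn2real (\<integral>\<^sup>+ x. I x \<partial>\<nu>)"
  have E: "(\<integral>\<^sup>+ x. I x \<partial>\<nu>) = ennreal E" "0 \<le> E" "E < c"
    using c by (cases "\<integral>\<^sup>+ x. I x \<partial>\<nu>"; simp add: E_def)+
  define b where "b = (E + c) / 2"
  have b: "E < b" "b < c" "0 < b"
    using E by (auto simp: b_def)
  \<comment> \<open>A captured mass above 1 - r gives closeness to \<nu>; above E / b it keeps the renormalised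
    cost below b.\<close>
  define \<theta> where "\<theta> = max (1 - r) (E / b)"
  have \<theta>: "\<theta> < 1" "1 - r \<le> \<theta>" "E \<le> \<theta> * b" "0 \<le> \<theta>"
  proof -
    have "E / b < 1" "0 \<le> E / b"
      using b E by auto
    then show "\<theta> < 1" "1 - r \<le> \<theta>" "0 \<le> \<theta>"
      using r by (auto simp: \<theta>_def)
    have "E / b * b \<le> \<theta> * b"
      using b by (intro mult_right_mono) (auto simp: \<theta>_def)
    then show "E \<le> \<theta> * b"
      using b by simp
  qed
  obtain J :: "nat set" and A x where J: "finite J" "disjoint_family_on A J" "\<And>i. A i \<in> sets borel"
    and pos: "\<And>i. i \<in> J \<Longrightarrow> measure \<nu> (A i) > 0" and mass: "\<theta> < (\<Sum>i\<in>J. measure \<nu> (A i))"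
    and sub: "\<And>i. i \<in> J \<Longrightarrow> A i \<subseteq> ball (x i) (2 * r)"
    and cheap: "\<And>i. i \<in> J \<Longrightarrow> I (x i) * emeasure \<nu> (A i) \<le> (\<integral>\<^sup>+ y. I y * indicator (A i) y \<partial>\<nu>)"
    using finite_quantization[OF \<nu> I r \<theta>(1)] by blast
  define p where "p = (\<Sum>i\<in>J. measure \<nu> (A i))"
  have p: "p > 0" "1 - r \<le> p" "E \<le> p * b"
  proof -
    have "\<theta> < p"
      using mass by (simp add: p_def)
    then show "p > 0" "1 - r \<le> p"
      using \<theta> by auto
    have "\<theta> * b \<le> p * b"
      using \<open>\<theta> < p\<close> b by simp
    then show "E \<le> p * b"
      using \<theta>(3) by simp
  qed
  have "J \<noteq> {}"
    using p(1) by (auto simp: p_def)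
  define h where "h i = enn2real (I (x i))" for i
  have total: "(\<Sum>i\<in>J. I (x i) * emeasure \<nu> (A i)) \<le> ennreal E"
  proof -
    have "(\<Sum>i\<in>J. I (x i) * emeasure \<nu> (A i)) \<le> (\<Sum>i\<in>J. \<integral>\<^sup>+ y. I y * indicator (A i) y \<partial>\<nu>)"
      by (rule sum_mono[OF cheap])
    also have "\<dots> = (\<integral>\<^sup>+ y. (\<Sum>i\<in>J. I y * indicator (A i) y) \<partial>\<nu>)"
      using I J sets by (intro nn_integral_sum[symmetric] borel_measurable_times borel_measurable_indicator) (auto cong: measurable_cong_sets)
    also have "\<dots> \<le> (\<integral>\<^sup>+ y. I y \<partial>\<nu>)"
    proof (intro nn_integral_mono)
      fix y
      have "(\<Sum>i\<in>J. I y * indicator (A i) y) = I y * indicator (\<Union>i\<in>J. A i) y"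
        by (simp add: indicator_UN_disjoint[OF J(1,2)] sum_distrib_left)
      then show "(\<Sum>i\<in>J. I y * indicator (A i) y) \<le> I y"
        by (simp split: split_indicator)
    qed
    finally show ?thesis
      using E by simp
  qed
  have I_x: "I (x i) = ennreal (h i)" if "i \<in> J" for i
  proof -
    have "I (x i) * emeasure \<nu> (A i) \<le> (\<Sum>i\<in>J. I (x i) * emeasure \<nu> (A i))"
      by (rule member_le_sum[OF that _ J(1)]) simp
    also have "\<dots> < \<infinity>"
      using total ennreal_less_top le_less_trans unfolding infinity_ennreal_def by blast
    finally show ?thesis
      using pos[OF that] by (cases "I (x i)") (auto simp: h_def \<nu>.emeasure_eq_measure ennreal_top_mult)
  qed
  have h_nonneg: "0 \<le> h i" for i
    by (simp add: h_def)
  have "ennreal (\<Sum>i\<in>J. h i * measure \<nu> (A i)) = (\<Sum>i\<in>J. I (x i) * emeasure \<nu> (A i))"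
    using h_nonneg by (subst sum_ennreal[symmetric]) (auto simp: I_x ennreal_mult \<nu>.emeasure_eq_measure)
  with total have "ennreal (\<Sum>i\<in>J. h i * measure \<nu> (A i)) \<le> ennreal E"
    by simp
  then have cost: "(\<Sum>i\<in>J. h i * measure \<nu> (A i)) \<le> p * b"
    using E(2) p(3) by (simp add: ennreal_le_iff)
  let ?w = "\<lambda>i. measure \<nu> (A i) / p"
  have w: "(\<Sum>i\<in>J. ?w i) = 1"
    using p(1) by (simp add: p_def sum_divide_distrib[symmetric])
  \<comment> \<open>The margin c - b makes the inequality at each x i strict, as the lower bound requires.\<close>
  have "\<forall>\<^sub>F n in sequentially. \<forall>i\<in>J. ennreal (exp (- (a n * (h i + (c - b))))) \<le> emeasure (\<mu> n) (ball (x i) r)"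
  proof (intro eventually_ball_finite J(1) ballI)
    fix i
    assume i: "i \<in> J"
    have "enn2ereal (I (x i)) < ereal (h i + (c - b))"
      using I_x[OF i] h_nonneg[of i] b(2) by (simp add: enn2ereal_ennreal)
    then show "\<forall>\<^sub>F n in sequentially. ennreal (exp (- (a n * (h i + (c - b))))) \<le> emeasure (\<mu> n) (ball (x i) r)"
      using ldp r unfolding ldp_lower_bound_iff[of a, OF a_pos] by (metis centre_in_ball open_ball)
  qed
  then show ?thesis
  proof eventually_elim
    case (elim n)
    interpret M: prob_space "\<mu> n"
      using mu by (rule borel_probsD)
    have le: "exp (- (a n * (h i + (c - b)))) \<le> measure (\<mu> n) (ball (x i) r)" if "i \<in> J" for i
      using elim that by (simp add: M.emeasure_eq_measure)
    then have B: "0 < measure (\<mu> n) (ball (x i) r)" if "i \<in> J" for i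
      using that exp_gt_zero less_le_trans by blast
    interpret weighted_conditioning "\<mu> n" J ?w "\<lambda>i. ball (x i) r"
      using mu J B p(1) w by unfold_locales auto
    let ?s = "conditional_mixture (\<mu> n) J ?w (\<lambda>i. ball (x i) r)"
    have "?s \<in> approximations_at_scale \<nu> r"
      by (rule conditional_mixture_is_approximation[OF \<nu> mu r J(1) \<open>J \<noteq> {}\<close> J(2,3) pos p_def p(2) sub B])
    moreover have "scaled_entropy a \<mu> n ?s \<le> ereal c"
    proof -
      have "- ln (measure (\<mu> n) (ball (x i) r)) \<le> a n * (h i + (c - b))" if "i \<in> J" for i
        using ln_mono[OF le[OF that]] by simp
      then have "(\<Sum>i\<in>J. ?w i * - ln (measure (\<mu> n) (ball (x i) r))) \<le> (\<Sum>i\<in>J. ?w i * (a n * (h i + (c - b))))"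
        using p(1) by (intro sum_mono mult_left_mono) auto
      also have "\<dots> = (\<Sum>i\<in>J. a n * (h i * measure \<nu> (A i) / p + ?w i * (c - b)))"
        by (intro sum.cong refl) (simp add: algebra_simps add_divide_distrib diff_divide_distrib)
      also have "\<dots> = a n * ((\<Sum>i\<in>J. h i * measure \<nu> (A i)) / p + (\<Sum>i\<in>J. ?w i) * (c - b))"
        by (simp only: sum_distrib_left[symmetric] sum.distrib sum_distrib_right[symmetric] sum_divide_distrib[symmetric])
      also have "\<dots> \<le> a n * (b + 1 * (c - b))"
        unfolding w using cost p(1) a_pos[of n]
        by (intro mult_left_mono add_right_mono) (auto simp: field_simps)
      also have "\<dots> = a n * c"
        by simp
      finally have "relative_entropy ?s (\<mu> n) \<le> ereal (a n * c)"
        by (intro order_trans[OF relative_entropy_conditional_mixture_le]) (rule iffD2[OF ereal_less_eq(3)])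
      then have "scaled_entropy a \<mu> n ?s \<le> ereal (1 / a n) * ereal (a n * c)"
        unfolding scaled_entropy_def using a_pos[of n] by (intro ereal_mult_left_mono) auto
      then show ?thesis
        using a_pos[of n] by simp
    qed
    ultimately show ?case
      by blast
  qed
qed

text \<open>The recovery at each fixed scale is turned into a recovery sequence by the diagonal argument, for
every \<open>c\<close> above \<open>\<nu>(I)\<close>.\<close>

lemma entropy_gamma_limsup_le_of_ldp_lower_bound:
  fixes \<mu> :: "nat \<Rightarrow> 'a::{metric_space, second_countable_topology} measure"
  assumes a_pos: "\<And>n. a n > 0"
    and mu: "\<And>n. \<mu> n \<in> borel_probs"
    and I: "I \<in> borel_measurable borel"
    and ldp: "ldp_lower_bound \<mu> a I"
    and \<nu>: "\<nu> \<in> borel_probs"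
  shows "gamma_limsup narrow_topology (scaled_entropy a \<mu>) \<nu> \<le> enn2ereal (\<integral>\<^sup>+ x. I x \<partial>\<nu>)"
proof (rule ccontr)
  assume "\<not> ?thesis"
  then obtain c where c: "enn2ereal (\<integral>\<^sup>+ x. I x \<partial>\<nu>) < ereal c"
    "ereal c < gamma_limsup narrow_topology (scaled_entropy a \<mu>) \<nu>"
    by (metis ereal_dense2 not_le)
  define r where "r m = 1 / real (Suc m)" for m
  have r: "r \<longlonglongrightarrow> 0" "\<And>m. r m > 0"
    unfolding r_def using LIMSEQ_Suc[OF lim_1_over_n] by simp_all
  have "gamma_limsup narrow_topology (scaled_entropy a \<mu>) \<nu> \<le> ereal c"
  proof (rule gamma_limsup_le_of_shrinking)
    show "\<nu> \<in> topspace narrow_topology"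
      using \<nu> by (simp add: topspace_narrow)
    show "\<forall>\<^sub>F m in sequentially. approximations_at_scale \<nu> (r m) \<subseteq> U"
      if "openin narrow_topology U" "\<nu> \<in> U" for U
      using that r by (rule approximations_enter_narrow_nbhds)
    have "approximations_at_scale \<nu> (r m) \<inter> topspace narrow_topology = approximations_at_scale \<nu> (r m)" for m
      by (auto simp: topspace_narrow approximations_at_scale_def)
    then show "\<forall>\<^sub>F n in sequentially. \<exists>s\<in>approximations_at_scale \<nu> (r m) \<inter> topspace narrow_topology.
        scaled_entropy a \<mu> n s \<le> ereal c" for m
      using entropy_recovery_of_ldp_lower_bound[OF a_pos mu I ldp \<nu> c(1) r(2)] by simp
  qed
  with c(2) show False
    by simp
qed

section \<open>Costs of compact sets\<close>

lemma hausdorff_edist_less_iff: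
  "hausdorff_edist d K K' < ereal \<epsilon> \<longleftrightarrow>
     (\<exists>\<delta>>0. \<delta> < \<epsilon> \<and> K \<subseteq> enlargement d \<delta> K' \<and> K' \<subseteq> enlargement d \<delta> K)"
  unfolding hausdorff_edist_def Inf_less_iff by auto

context Metric_space
begin

lemma enlargement_trans:
  assumes "M = UNIV" "A \<subseteq> enlargement d \<delta> B" "B \<subseteq> enlargement d \<eta> C"
  shows "A \<subseteq> enlargement d (\<delta> + \<eta>) C"
proof
  fix x
  assume "x \<in> A"
  then obtain y where y: "y \<in> B" "d y x < \<delta>"
    using assms(2) by (auto simp: enlargement_def)
  then obtain z where "z \<in> C" "d z y < \<eta>"
    using assms(3) by (auto simp: enlargement_def)
  then show "x \<in> enlargement d (\<delta> + \<eta>) C"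
    using y triangle[of z y x] assms(1) by (force simp: enlargement_def)
qed

end

lemma subset_enlargement_self:
  assumes "Metric_space UNIV d" "\<epsilon> > 0"
  shows "A \<subseteq> enlargement d \<epsilon> A"
  using assms by (auto simp: enlargement_def Metric_space.mdist_zero intro!: bexI)

lemma topspace_hausdorff:
  fixes d :: "'a::topological_space \<Rightarrow> 'a \<Rightarrow> real"
  assumes "Metric_space UNIV d"
  shows "topspace (hausdorff_topology d) = {K. compact K}"
proof -
  have "hausdorff_edist d K K < ereal 1" for K
    unfolding hausdorff_edist_less_iff
    using subset_enlargement_self[OF assms, of "1 / 2" K] by (intro exI[of _ "1 / 2"]) simp
  then have "K \<in> {K'. compact K' \<and> hausdorff_edist d K K' < ereal 1}" if "compact K" for K
    using that by blast
  moreover have "{K'. compact K' \<and> hausdorff_edist d K K' < ereal 1} \<in>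
      {{K'. compact K' \<and> hausdorff_edist d K K' < ereal \<epsilon>} | K \<epsilon>. compact K \<and> \<epsilon> > 0}"
    if "compact K" for K
    using that zero_less_one by blast
  ultimately have "compact K \<Longrightarrow> K \<in> topspace (hausdorff_topology d)" for K
    unfolding hausdorff_topology_def topology_generated_by_topspace by (rule UnionI[rotated])
  moreover have "topspace (hausdorff_topology d) \<subseteq> {K. compact K}"
    unfolding hausdorff_topology_def topology_generated_by_topspace by auto
  ultimately show ?thesis
    by auto
qed

text \<open>By the triangle inequality for enlargements, every ball around another centre that contains \<open>K\<close>
contains a small ball around \<open>K\<close>.\<close>

lemma hausdorff_balls_shrink:
  fixes d :: "'a::topological_space \<Rightarrow> 'a \<Rightarrow> real"
  assumes d: "Metric_space UNIV d" and U: "openin (hausdorff_topology d) U" "K \<in> U"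
  shows "\<forall>\<^sub>F m in sequentially. {K'. compact K' \<and> hausdorff_edist d K K' < ereal (1 / Suc m)} \<subseteq> U"
proof (rule eventually_subset_generated_topology)
  show "openin (topology_generated_by
     {{K'. compact K' \<and> hausdorff_edist d K K' < ereal \<epsilon>} | K \<epsilon>. compact K \<and> \<epsilon> > 0}) U"
    using U(1) by (simp add: hausdorff_topology_def)
next
  fix B
  assume "B \<in> {{K'. compact K' \<and> hausdorff_edist d K K' < ereal \<epsilon>} | K \<epsilon>. compact K \<and> \<epsilon> > 0}"
    and "K \<in> B"
  then obtain K0 \<epsilon> where B: "B = {K'. compact K' \<and> hausdorff_edist d K0 K' < ereal \<epsilon>}"
    and "hausdorff_edist d K0 K < ereal \<epsilon>"
    by auto
  then obtain \<delta> where \<delta>: "\<delta> > 0" "\<delta> < \<epsilon>" "K0 \<subseteq> enlargement d \<delta> K" "K \<subseteq> enlargement d \<delta> K0"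
    unfolding hausdorff_edist_less_iff by auto
  obtain N where N: "1 / Suc N < \<epsilon> - \<delta>"
    using \<delta>(2) nat_approx_posE[of "\<epsilon> - \<delta>"] by auto
  have "hausdorff_edist d K0 K' < ereal \<epsilon>"
    if m: "m \<ge> N" and K': "hausdorff_edist d K K' < ereal (1 / Suc m)" for m K'
  proof -
    obtain \<eta> where \<eta>: "\<eta> > 0" "\<eta> < 1 / Suc m" "K \<subseteq> enlargement d \<eta> K'" "K' \<subseteq> enlargement d \<eta> K"
      using K' unfolding hausdorff_edist_less_iff by auto
    have "1 / Suc m \<le> 1 / Suc N"
      using m by (simp add: frac_le)
    moreover have "K0 \<subseteq> enlargement d (\<delta> + \<eta>) K'" "K' \<subseteq> enlargement d (\<eta> + \<delta>) K0"
      using Metric_space.enlargement_trans[OF d refl] \<delta> \<eta> by blast+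
    ultimately show ?thesis
      using \<eta>(1,2) \<delta>(1) N unfolding hausdorff_edist_less_iff
      by (intro exI[of _ "\<delta> + \<eta>"]) (auto simp: add.commute)
  qed
  then show "\<forall>\<^sub>F m in sequentially. {K'. compact K' \<and> hausdorff_edist d K K' < ereal (1 / Suc m)} \<subseteq> B"
    unfolding eventually_sequentially B by auto
qed (rule U)

text \<open>Adding to \<open>K\<close> a compact piece of a small ball around \<open>x \<in> K\<close> moves it little in the Hausdorff
distance. The piece is chosen by inner regularity with mass above \<open>exp (- a n * c)\<close>, which is
possible because the ball has mass at least \<open>exp (- a n * b)\<close> for some \<open>b < c\<close>.\<close>

lemma compact_costs_of_ldp_lower_bound:
  fixes \<mu> :: "nat \<Rightarrow> 'a::polish_space measure"
  assumes a_pos: "\<And>n. a n > 0"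
    and mu: "\<And>n. \<mu> n \<in> borel_probs"
    and d: "Metric_space UNIV d" "Metric_space.mtopology UNIV d = euclidean"
    and ldp: "ldp_lower_bound \<mu> a I"
    and K: "compact K"
  shows "gamma_limsup (hausdorff_topology d) (log_cost a \<mu>) K \<le> (INF x\<in>K. enn2ereal (I x))"
proof (intro INF_greatest)
  interpret Metric_space UNIV d
    by (rule d)
  fix x
  assume "x \<in> K"
  show "gamma_limsup (hausdorff_topology d) (log_cost a \<mu>) K \<le> enn2ereal (I x)"
  proof (rule ccontr)
    assume "\<not> ?thesis"
    then obtain c where c: "enn2ereal (I x) < ereal c"
      "ereal c < gamma_limsup (hausdorff_topology d) (log_cost a \<mu>) K"
      by (metis ereal_dense2 not_le)
    then obtain b where b: "enn2ereal (I x) < ereal b" "b < c"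
      by (metis ereal_dense2 less_ereal.simps(1))
    have "gamma_limsup (hausdorff_topology d) (log_cost a \<mu>) K \<le> ereal c"
    proof (rule gamma_limsup_le_of_shrinking)
      show "K \<in> topspace (hausdorff_topology d)"
        using K topspace_hausdorff[OF d(1)] by simp
    next
      fix U
      assume "openin (hausdorff_topology d) U" "K \<in> U"
      then show "\<forall>\<^sub>F m in sequentially.
          {K'. compact K' \<and> hausdorff_edist d K K' < ereal (1 / Suc m)} \<subseteq> U"
        by (rule hausdorff_balls_shrink[OF d(1)])
    next
      fix m
      define \<delta> where "\<delta> = 1 / (2 * real (Suc m))"
      have \<delta>: "\<delta> > 0" "\<delta> < 1 / Suc m"
        by (auto simp: \<delta>_def field_simps)
      have V: "open (mball x \<delta>)" "x \<in> mball x \<delta>"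
        using openin_mball[of x \<delta>] d(2) \<delta>(1) by auto
      have "\<forall>\<^sub>F n in sequentially. ennreal (exp (- (a n * b))) \<le> emeasure (\<mu> n) (mball x \<delta>)"
        using ldp V b(1) unfolding ldp_lower_bound_iff[of a, OF a_pos] by blast
      then show "\<forall>\<^sub>F n in sequentially.
        \<exists>K'\<in>{K'. compact K' \<and> hausdorff_edist d K K' < ereal (1 / Suc m)} \<inter> topspace (hausdorff_topology d).
          log_cost a \<mu> n K' \<le> ereal c"
      proof eventually_elim
        case (elim n)
        have M: "prob_space (\<mu> n)" "sets (\<mu> n) = sets borel"
          using mu[of n] by (auto simp: space_prob_algebra)
        then interpret M: prob_space "\<mu> n"
          by simp
        have "ennreal (exp (- (a n * c))) < ennreal (exp (- (a n * b)))"
          using b(2) a_pos[of n] by (simp add: ennreal_less_iff)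
        also note elim
        also have "emeasure (\<mu> n) (mball x \<delta>) = (SUP K'\<in>{K'. K' \<subseteq> mball x \<delta> \<and> compact K'}. emeasure (\<mu> n) K')"
          using V(1) M by (intro inner_regular) auto
        finally obtain C where C: "C \<subseteq> mball x \<delta>" "compact C" "ennreal (exp (- (a n * c))) < emeasure (\<mu> n) C"
          by (auto simp: less_SUP_iff)
        let ?K = "K \<union> C"
        have "compact ?K"
          using K C by auto
        moreover have "y \<in> enlargement d \<delta> K" if "y \<in> C" for y
          using in_mball[of y x \<delta>] that C(1) \<open>x \<in> K\<close> unfolding enlargement_def by blast
        then have "?K \<subseteq> enlargement d \<delta> K"
          using subset_enlargement_self[OF d(1) \<delta>(1), of K] by blast
        then have "hausdorff_edist d K ?K < ereal (1 / Suc m)"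
          using subset_enlargement_self[OF d(1) \<delta>(1), of ?K] \<delta>
          unfolding hausdorff_edist_less_iff by auto
        moreover have "emeasure (\<mu> n) C \<le> emeasure (\<mu> n) ?K"
          using K C(2) M by (intro emeasure_mono) (auto intro: borel_compact)
        then have "log_cost a \<mu> n ?K \<le> ereal c"
          using C(3) a_pos[of n] by (subst log_cost_le_iff) auto
        ultimately show ?case
          unfolding topspace_hausdorff[OF d(1)] by blast
      qed
    qed
    with c(2) show False
      by simp
  qed
qed

text \<open>Singletons suffice: a set Hausdorff-close to \<open>{x}\<close> lies in a small ball around \<open>x\<close>, hence in \<open>U\<close>.\<close>

lemma ldp_lower_bound_of_compact_costs:
  fixes \<mu> :: "nat \<Rightarrow> 'a::metric_space measure"
  assumes a_pos: "\<And>n. a n > 0"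
    and sets: "\<And>n. sets (\<mu> n) = sets borel"
    and d: "Metric_space UNIV d" "Metric_space.mtopology UNIV d = euclidean"
    and L: "\<And>x. gamma_limsup (hausdorff_topology d) (log_cost a \<mu>) {x} \<le> enn2ereal (I x)"
  shows "ldp_lower_bound \<mu> a I"
  unfolding ldp_lower_bound_iff[of a, OF a_pos]
proof (intro allI impI)
  interpret Metric_space UNIV d
    by (rule d)
  fix U x c
  assume U: "open U" "x \<in> U" and c: "enn2ereal (I x) < ereal c"
  have "gamma_limsup (hausdorff_topology d) (log_cost a \<mu>) {x} < ereal c"
    using L c by (rule le_less_trans)
  then obtain K where K: "range K \<subseteq> topspace (hausdorff_topology d)"
    "limitin (hausdorff_topology d) K {x} sequentially"
    "\<forall>\<^sub>F n in sequentially. log_cost a \<mu> n (K n) < ereal c"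
    by (rule gamma_limsup_lessD)
  have "openin mtopology U"
    using U(1) d(2) by simp
  then obtain r where r: "r > 0" "mball x r \<subseteq> U"
    using U(2) unfolding openin_mtopology by blast
  let ?B = "{K'. compact K' \<and> hausdorff_edist d {x} K' < ereal r}"
  have "openin (hausdorff_topology d) ?B"
    unfolding hausdorff_topology_def
  proof (rule topology_generated_by_Basis)
    show "?B \<in> {{K'. compact K' \<and> hausdorff_edist d K K' < ereal \<epsilon>} | K \<epsilon>. compact K \<and> \<epsilon> > 0}"
      by (intro CollectI exI[of _ "{x}"] exI[of _ r] conjI refl r(1) compact_sing)
  qed
  moreover have "hausdorff_edist d {x} {x} < ereal r"
    unfolding hausdorff_edist_less_iff
    using subset_enlargement_self[OF d(1), of "r / 2" "{x}"] r(1) by (intro exI[of _ "r / 2"]) simp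
  then have "{x} \<in> ?B"
    by simp
  ultimately have "\<forall>\<^sub>F n in sequentially. K n \<in> ?B"
    using K(2) unfolding limitin_def by blast
  with K(3) show "\<forall>\<^sub>F n in sequentially. ennreal (exp (- (a n * c))) \<le> emeasure (\<mu> n) U"
  proof eventually_elim
    case (elim n)
    obtain \<delta> where "\<delta> < r" "K n \<subseteq> enlargement d \<delta> {x}"
      using elim(2) unfolding hausdorff_edist_less_iff by blast
    then have "K n \<subseteq> mball x r"
      by (auto simp: enlargement_def)
    then have "emeasure (\<mu> n) (K n) \<le> emeasure (\<mu> n) U"
      using r(2) U(1) by (intro emeasure_mono) (auto simp: sets)
    then show ?case
      using elim(1) log_cost_le_iff[of a n \<mu> "K n" c, OF a_pos] by (auto intro: order_trans)
  qed
qed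

section \<open>Equivalence of the lower bounds\<close>

theorem theorem3p4:
  fixes a :: "nat \<Rightarrow> real"
    and \<mu> :: "nat \<Rightarrow> 'a::polish_space measure"
    and I :: "'a \<Rightarrow> ennreal"
    and d :: "'a \<Rightarrow> 'a \<Rightarrow> real"
  assumes a_pos: "\<And>n. a n > 0"
    and a_lim: "filterlim a at_top sequentially"
    and mu: "\<And>n. \<mu> n \<in> borel_probs"
    and I_meas: "I \<in> borel_measurable borel"
    and d_metric: "Metric_space UNIV d"
    and d_compatible: "Metric_space.mtopology UNIV d = euclidean"
  defines "P1 \<equiv> ldp_lower_bound \<mu> a I"
    and "P2 \<equiv> \<forall>\<phi> :: nat \<Rightarrow> 'a \<Rightarrow> ereal. (\<forall>n. \<phi> n \<in> borel_measurable borel) \<longrightarrow>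
           liminf (\<lambda>n. ereal (1 / a n) *
               ln_ennreal (\<integral>\<^sup>+ x. exp_ereal (ereal (a n) * \<phi> n x) \<partial>\<mu> n))
             \<ge> (SUP x. if I x = \<infinity> then -\<infinity> else gamma_liminf euclidean \<phi> x - enn2ereal (I x))"
    and "H1 \<equiv> \<forall>x. gamma_limsup narrow_topology (scaled_entropy a \<mu>) (return borel x)
                   \<le> enn2ereal (I x)"
    and "H2 \<equiv> \<forall>\<nu>\<in>borel_probs. gamma_limsup narrow_topology (scaled_entropy a \<mu>) \<nu>
                   \<le> enn2ereal (\<integral>\<^sup>+ x. I x \<partial>\<nu>)"
    and "L \<equiv> \<forall>K. compact K \<longrightarrow> gamma_limsup (hausdorff_topology d) (log_cost a \<mu>) K
                   \<le> (INF x\<in>K. enn2ereal (I x))"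
  shows "(P1 \<longleftrightarrow> P2) \<and> (P1 \<longleftrightarrow> H1) \<and> (P1 \<longleftrightarrow> H2) \<and> (lower_semicontinuous I \<longrightarrow> (P1 \<longleftrightarrow> L))"
proof -
  have sets: "sets (\<mu> n) = sets borel" for n
    using mu by (rule borel_probsD)
  have P1_P2: "P1 \<longleftrightarrow> P2"
  proof
    assume P1
    then show P2
      unfolding P1_def P2_def
      using exponential_integrals_of_ldp_lower_bound[of a \<mu> I, OF a_pos sets]
      by (intro allI impI SUP_least) auto
  next
    assume P2
    show P1
      unfolding P1_def
    proof (rule ldp_lower_bound_of_exponential_integrals[of a, OF a_pos sets])
      fix \<phi> :: "nat \<Rightarrow> 'a \<Rightarrow> ereal" and x
      assume meas: "\<And>n. \<phi> n \<in> borel_measurable borel" and fin: "I x \<noteq> \<infinity>"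
      have "gamma_liminf euclidean \<phi> x - enn2ereal (I x) \<le>
          (SUP x. if I x = \<infinity> then -\<infinity> else gamma_liminf euclidean \<phi> x - enn2ereal (I x))"
        using fin by (intro SUP_upper2[of x]) auto
      also have "\<dots> \<le> liminf (\<lambda>n. ereal (1 / a n) *
               ln_ennreal (\<integral>\<^sup>+ x. exp_ereal (ereal (a n) * \<phi> n x) \<partial>\<mu> n))"
        using \<open>P2\<close> meas unfolding P2_def by blast
      finally show "gamma_liminf euclidean \<phi> x - enn2ereal (I x) \<le> liminf (\<lambda>n. ereal (1 / a n) *
               ln_ennreal (\<integral>\<^sup>+ x. exp_ereal (ereal (a n) * \<phi> n x) \<partial>\<mu> n))" .
    qed
  qed
  have P1_H2: "P1 \<Longrightarrow> H2"
    unfolding P1_def H2_def using entropy_gamma_limsup_le_of_ldp_lower_bound[of a \<mu> I, OF a_pos mu I_meas]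
    by blast
  have H2_H1: "H1" if H2
    unfolding H1_def
  proof
    fix x
    have "(\<integral>\<^sup>+ y. I y \<partial>return borel x) = I x"
      using I_meas by (intro nn_integral_return) auto
    then show "gamma_limsup narrow_topology (scaled_entropy a \<mu>) (return borel x) \<le> enn2ereal (I x)"
      using that return_in_borel_probs[of x] unfolding H2_def by metis
  qed
  have H1_P1: "H1 \<Longrightarrow> P1"
    unfolding P1_def H1_def using ldp_lower_bound_of_entropy_at_points[of a \<mu> I, OF a_pos a_lim mu] by blast
  have P1_L: "P1 \<longleftrightarrow> L"
  proof
    assume P1
    then show L
      unfolding P1_def L_def
      using compact_costs_of_ldp_lower_bound[of a \<mu> d I, OF a_pos mu d_metric d_compatible] by blast
  next
    assume L
    have "gamma_limsup (hausdorff_topology d) (log_cost a \<mu>) {x} \<le> enn2ereal (I x)" for x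
      using \<open>L\<close>[unfolded L_def, rule_format, OF compact_sing[of x]] by simp
    then show P1
      unfolding P1_def
      by (rule ldp_lower_bound_of_compact_costs[of a, OF a_pos sets d_metric d_compatible])
  qed
  show ?thesis
    using P1_P2 P1_H2 H2_H1 H1_P1 P1_L by blast
qed

end
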